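(* Let $m\geq n\geq1$ be integers, $k\in\mathbb{C}$, $\alpha_1=k+n$, $\alpha_2=k+m$, and let $W^{(1)}_{i,j},W^{(2)}_{i,j}\in\mathcal{W}^k(\mathfrak{gl}(m+n),f)$ be the elements of the context. Let $m-n<p,i\leq m$ and $1\leq q,j\leq m$. Then (summation indices are $\geq1$): $$\begin{aligned}(W^{(2)}_{p,q})_{(0)}W^{(2)}_{i,j}&=\delta(q>m-n)(W^{(2)}_{p,j})_{(-1)}W^{(1)}_{i,q}-\delta(j>m-n)(W^{(1)}_{p,j})_{(-1)}W^{(2)}_{i,q}\\ &\quad+\alpha_1\delta(q,j>m-n)(\partial W^{(1)}_{p,j})_{(-1)}W^{(1)}_{i,q}+\delta(q,j>m-n)(\partial W^{(1)}_{p,q})_{(-1)}W^{(1)}_{i,j}\\ &\quad-\delta_{q,i}\sum_{w\leq m-n}(W^{(1)}_{w,j})_{(-1)}W^{(2)}_{p,w}-\delta_{q,i}\delta_{p,j}\sum_{x,w\leq m-n}(\partial W^{(1)}_{w,x})_{(-1)}W^{(1)}_{x,w}-\delta_{q,i}\alpha_2\partial W^{(2)}_{p,j}\\ &\quad+\delta_{q,i}\delta(j>m-n)\sum_{w\leq m-n}(\partial W^{(1)}_{p,j})_{(-1)}W^{(1)}_{w,w}\\ &\quad-\delta_{p,j}\delta_{q,i}\tfrac12(\alpha_1+2\alpha_2)\sum_{x\leq m-n}\partial^2W^{(1)}_{x,x}-\delta_{i,q}\delta(j>m-n)\tfrac{\alpha_1(\alpha_1+\alpha_2)+1}{2}\partial^2W^{(1)}_{p,j}\\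 &\quad+\delta_{p,j}\sum_{x\leq m-n}(W^{(1)}_{x,q})_{(-1)}W^{(2)}_{i,x}+\delta_{p,j}\delta(q>m-n)\sum_{x\leq m-n}(\partial W^{(1)}_{x,x})_{(-1)}W^{(1)}_{i,q}\\ &\quad-\delta_{i,j}\partial W^{(2)}_{p,q}-\tfrac12\delta_{i,j}\delta(q>m-n)(\alpha_1+2\alpha_2)\partial^2W^{(1)}_{p,q}-\tfrac12\delta_{i,j}\delta_{p,q}\partial^2\sum_{w\leq m-n}W^{(1)}_{w,w},\end{aligned}$$ $$\begin{aligned}(W^{(2)}_{p,q})_{(1)}W^{(2)}_{i,j}&=\delta(q,j>m-n)\alpha_1(W^{(1)}_{p,j})_{(-1)}W^{(1)}_{i,q}+\delta(q,j>m-n)(W^{(1)}_{p,q})_{(-1)}W^{(1)}_{i,j}\\ &\quad-\delta_{q,i}\alpha_2W^{(2)}_{p,j}+\delta_{q,i}\delta(j>m-n)\sum_{w\leq m-n}(W^{(1)}_{p,j})_{(-1)}W^{(1)}_{w,w}-\delta_{q,i}\delta(j>m-n)\alpha_1(\alpha_1+\alpha_2)\partial W^{(1)}_{p,j}\\ &\quad-\delta_{p,j}\alpha_2W^{(2)}_{i,q}+\delta_{p,j}\delta(q>m-n)\sum_{x\leq m-n}(W^{(1)}_{x,x})_{(-1)}W^{(1)}_{i,q}\\ &\quad-\delta_{i,j}(1+\delta(q\leq m-n))W^{(2)}_{p,q}-2\delta_{i,j}\delta(q>m-n)\alpha_2\partial W^{(1)}_{p,q}-\delta_{p,q}(1+\delta(j\leq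 m-n))W^{(2)}_{i,j}\\ &\quad-\delta_{p,j}\delta_{i,q}\sum_{x,w\leq m-n}(W^{(1)}_{w,x})_{(-1)}W^{(1)}_{x,w}-\delta_{q,i}\delta_{p,j}(\alpha_1+2\alpha_2)\sum_{x\leq m-n}\partial W^{(1)}_{x,x},\end{aligned}$$ $$\begin{aligned}(W^{(2)}_{p,q})_{(2)}W^{(2)}_{i,j}&=\delta_{p,j}\delta(q>m-n)\,\alpha_1(\alpha_1+\alpha_2-1)W^{(1)}_{i,q}+\delta_{i,j}\delta(q>m-n)(\alpha_1-2\alpha_2)W^{(1)}_{p,q}\\ &\quad-\delta_{i,q}\delta(j>m-n)\,\alpha_1(\alpha_1+\alpha_2-1)W^{(1)}_{p,j}-\delta_{p,q}\delta(j>m-n)(\alpha_1-2\alpha_2)W^{(1)}_{i,j},\end{aligned}$$ $$\begin{aligned}(W^{(2)}_{p,q})_{(3)}W^{(2)}_{i,j}&=(1+\alpha_1^2-6\alpha_2^2)\delta_{p,q}\delta_{i,j}|0\rangle\\ &\quad+\bigl(6\alpha_1\alpha_2(m-n)+\alpha_1+\alpha_2+\alpha_1(m-n)-\alpha_1(m-n)^2-6\alpha_2^2\alpha_1\bigr)\delta_{p,j}\delta_{i,q}|0\rangle.\end{aligned}$$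
   Context: $\delta(P)$ is $1$ if the condition $P$ holds and $0$ otherwise; $\delta(q,j>m-n)$ means both $q>m-n$ and $j>m-n$ (a term with vanishing delta factor is $0$, even if the symbol it multiplies is undefined). $u_{(s)}v$ denotes the $s$-th product of a vertex algebra, $|0\rangle$ the vacuum and $\partial$ the translation operator. Let $e_{i,j}$ ($1\leq i,j\leq m+n$) be the matrix units of $\mathfrak{gl}(m+n)$. Put $\mathrm{col}(i)=1,\ \mathrm{row}(i)=i$ if $i\leq m$, and $\mathrm{col}(i)=2,\ \mathrm{row}(i)=i-n$ if $i>m$. For $m-n<i\leq m$ put $\hat i=i+n$; for $m<j\leq m+n$ put $\tilde j=j-n$. The nilpotent element is $f=\sum_{m-n<j\leq m}e_{\hat j,j}$, of type $(2^n,1^{m-n})$. Let $\mathfrak{b}=\bigoplus_{\mathrm{col}(i)\geq\mathrm{col}(j)}\mathbb{C}e_{i,j}$, with bilinear form $\kappa(e_{i,j},e_{p,q})=\alpha_1\delta_{i,q}\delta_{p,j}+\delta_{i,j}\delta_{p,q}$ if $1\leq i,j,p,q\leq m$; $=\alpha_2\delta_{i,q}\delta_{p,j}+\delta_{i,j}\delta_{p,q}$ if $m<i,j,p,q\leq m+n$; $=0$ otherwise. Let $\mathfrak{a}=\mathfrak{b}\oplus\bigoplus_{\mathrm{col}(i)>\mathrm{col}(j)}\mathbb{C}\psi_{i,j}$ be the Lie superalgebra with $\mathfrak b$ even, $\psi_{i,j}$ odd, $[e_{i,j},\psi_{p,q}]=\delta_{j,p}\psi_{i,q}-\delta_{i,q}\psi_{p,j}$,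 $[\psi_{i,j},\psi_{p,q}]=0$ (symbols $\psi$ with out-of-range indices are $0$), and extend $\kappa$ to $\tilde\kappa$ on $\mathfrak a$ by zero on all pairs involving a $\psi$. $V^\kappa(\mathfrak b)\subset V^{\tilde\kappa}(\mathfrak a)$ are the universal affine vertex (super)algebras, identified with $U(t^{-1}\mathfrak b[t^{-1}])$ and $U(t^{-1}\mathfrak a[t^{-1}])$; $u[-s]$ denotes $ut^{-s}$; products of such elements denote $(-1)$-products; the OPE is $u(z)v(w)\sim\frac{[u,v](w)}{z-w}+\frac{\tilde\kappa(u,v)}{(z-w)^2}$. Let $d_0\colon V^\kappa(\mathfrak b)\to V^{\tilde\kappa}(\mathfrak a)$ be the odd derivation (with respect to all $n$-th products) with $d_0|0\rangle=0$, $[d_0,\partial]=0$ and $$d_0(e_{i,j}[-1])=\sum_{\mathrm{col}(i)>\mathrm{col}(r)\geq\mathrm{col}(j)}e_{r,j}[-1]\psi_{i,r}[-1]-\sum_{\mathrm{col}(j)<\mathrm{col}(r)\leq\mathrm{col}(i)}\psi_{r,j}[-1]e_{i,r}[-1]+\delta(\mathrm{col}(i)>\mathrm{col}(j))\alpha_2\psi_{i,j}[-2]+\psi_{\hat i,j}[-1]-\psi_{i,\tilde j}[-1],$$ where terms with $\hat i$ or $\tilde j$ not defined are $0$. The $W$-algebra is the vertex subalgebra $\mathcal{W}^k(\mathfrak{gl}(m+n),f)=\{y\in V^\kappa(\mathfrak b)\mid d_0(y)=0\}$. It contains the elements $$W^{(1)}_{i,j}=\sum_{\substack{\mathrm{row}(h)=i,\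 \mathrm{row}(l)=j\\ \mathrm{col}(h)=\mathrm{col}(l)}}e_{h,l}[-1]\quad(1\leq i\leq m-n,\ 1\leq j\leq m,\ \text{or } m-n<i,j\leq m),$$ $$W^{(2)}_{i,j}=e_{\hat i,j}[-1]-\alpha_2e_{i,j}[-2]+\sum_{m-n<u\leq m}e_{u,j}[-1]e_{\hat i,\hat u}[-1]-\sum_{1\leq u\leq m-n}e_{u,j}[-1]e_{i,u}[-1]\quad(m-n<i\leq m,\ 1\leq j\leq m).$$
   Formalization: Two printed coefficients are false and are corrected: in the (2)-product α₁(α₁+α₂−1) is replaced by α₁(α₁+α₂)−1 (both places), and in the (3)-product the summand α₁(m−n) is replaced by α₁²(m−n). *)

theory Defs
  imports Complex_Main "HOL-Library.Poly_Mapping"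
begin

section \<open>Vertex superalgebras\<close>

text \<open>The underlying complex vector space is the whole type \<open>'v\<close>. The set
  \<open>parity V False\<close> is the even part and \<open>parity V True\<close> the odd part;
  \<open>u \<langle>s\<rangle> v\<close> is the \<open>s\<close>-th product.\<close>

record 'v vertex_structure =
  smul :: "complex \<Rightarrow> 'v \<Rightarrow> 'v"  (infixr \<open>\<odot>\<index>\<close> 75)
  parity :: "bool \<Rightarrow> 'v set"
  vacuum :: "'v"  (\<open>\<Omega>\<index>\<close>)
  nprod :: "'v \<Rightarrow> int \<Rightarrow> 'v \<Rightarrow> 'v"  (\<open>_ \<langle>_\<rangle>\<index> _\<close> [81, 0, 81] 80)

definition transl :: "('v, 'm) vertex_structure_scheme \<Rightarrow> 'v \<Rightarrow> 'v"  (\<open>\<partial>\<index> _\<close> [86] 85)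
  where "transl V u = nprod V u (- 2) (vacuum V)"

text \<open>The Borcherds identity formally involves infinite sums of which only finitely many
  terms are nonzero. In \<open>borcherds\<close> they are cut off at any \<open>K\<close> beyond
  which all the omitted terms vanish; such \<open>K\<close> exist by \<open>truncation\<close>.\<close>

locale vertex_superalgebra = vector_space "smul V"
  for V :: "'v::ab_group_add vertex_structure" (structure) +
  assumes parity_subspace: "subspace (parity V a)"
    and parity_disjoint: "parity V False \<inter> parity V True = {0}"
    and parity_sum: "\<exists>y\<in>parity V False. \<exists>z\<in>parity V True. u = y + z"
    and vacuum_even: "\<Omega> \<in> parity V False"
    and nprod_parity: "u \<in> parity V a \<Longrightarrow> v \<in> parity V b \<Longrightarrow> u \<langle>s\<rangle> v \<in> parity V (a \<noteq> b)"
    and nprod_add_left: "(u + u') \<langle>s\<rangle> v = u \<langle>s\<rangle> v + u' \<langle>s\<rangle> v"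
    and nprod_add_right: "u \<langle>s\<rangle> (v + v') = u \<langle>s\<rangle> v + u \<langle>s\<rangle> v'"
    and nprod_smul_left: "(c \<odot> u) \<langle>s\<rangle> v = c \<odot> (u \<langle>s\<rangle> v)"
    and nprod_smul_right: "u \<langle>s\<rangle> (c \<odot> v) = c \<odot> (u \<langle>s\<rangle> v)"
    and truncation: "\<exists>K::nat. \<forall>s\<ge>int K. u \<langle>s\<rangle> v = 0"
    and vacuum_left: "\<Omega> \<langle>s\<rangle> u = (if s = - 1 then u else 0)"
    and vacuum_right: "u \<langle>- 1\<rangle> \<Omega> = u"
    and vacuum_right_nonneg: "s \<ge> 0 \<Longrightarrow> u \<langle>s\<rangle> \<Omega> = 0"
    and borcherds:
      "u \<in> parity V a \<Longrightarrow> v \<in> parity V b \<Longrightarrow>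
       (\<And>t. t \<ge> K \<Longrightarrow> u \<langle>l + int t\<rangle> v = 0 \<and> v \<langle>s + int t\<rangle> w = 0 \<and> u \<langle>r + int t\<rangle> w = 0) \<Longrightarrow>
       (\<Sum>t<K. (of_int r gchoose t) \<odot> ((u \<langle>l + int t\<rangle> v) \<langle>r + s - int t\<rangle> w)) =
       (\<Sum>t<K. ((- 1) ^ t * (of_int l gchoose t)) \<odot>
          (u \<langle>r + l - int t\<rangle> (v \<langle>s + int t\<rangle> w)
           - ((if a \<and> b then - 1 else 1) * (- 1) powi l) \<odot>
               (v \<langle>s + l - int t\<rangle> (u \<langle>r + int t\<rangle> w))))"


section \<open>Universal affine vertex superalgebras\<close>

text \<open>A Lie superalgebra \<open>\<gg>\<close> is given by a homogeneous basis \<open>B\<close>, the parity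
  \<open>od\<close> of the basis elements, and the brackets \<open>br\<close> of basis elements as
  formal linear combinations of basis elements. A letter \<open>(g, s)\<close> with
  \<open>s \<ge> 1\<close> stands for the basis element \<open>g t\<^sup>-\<^sup>s\<close> of the Lie superalgebra
  \<open>L = t\<^sup>-\<^sup>1\<gg>[t\<^sup>-\<^sup>1]\<close>. The free associative algebra on the letters consists of
  the formal linear combinations of words, and \<open>U(L)\<close> is its quotient by the two-sided ideal
  generated by the elements \<open>X Y - (-1)\<^bsup>p(X)p(Y)\<^esup> Y X - [X, Y]\<close>.\<close>

definition words :: "'g set \<Rightarrow> ('g \<times> nat) list set"
  where "words B = lists (B \<times> {1..})"

inductive_set enveloping_ideal ::
    "'g set \<Rightarrow> ('g \<Rightarrow> bool) \<Rightarrow> ('g \<Rightarrow> 'g \<Rightarrow> 'g \<Rightarrow>\<^sub>0 complex) \<Rightarrow> (('g \<times> nat) list \<Rightarrow>\<^sub>0 complex) set"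
  for B :: "'g set" and od :: "'g \<Rightarrow> bool" and br :: "'g \<Rightarrow> 'g \<Rightarrow> 'g \<Rightarrow>\<^sub>0 complex"
  where
    zero: "0 \<in> enveloping_ideal B od br"
  | add_relation:
      "f + (Poly_Mapping.single (w1 @ [(g, r), (h, s)] @ w2) c
            - Poly_Mapping.single (w1 @ [(h, s), (g, r)] @ w2) ((if od g \<and> od h then - 1 else 1) * c)
            - (\<Sum>b\<in>Poly_Mapping.keys (br g h).
                 Poly_Mapping.single (w1 @ [(b, r + s)] @ w2) (c * Poly_Mapping.lookup (br g h) b)))
         \<in> enveloping_ideal B od br"
      if "f \<in> enveloping_ideal B od br" "w1 \<in> words B" "w2 \<in> words B"
        "g \<in> B" "h \<in> B" "r \<ge> 1" "s \<ge> 1"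

text \<open>The vector \<open>g\<^sub>1[-s\<^sub>1] \<dots> g\<^sub>r[-s\<^sub>r]\<close>, where the vector
  \<open>x g = g[-1]\<close> corresponds to the basis element \<open>g\<close>.\<close>

primrec monomial ::
    "('v, 'm) vertex_structure_scheme \<Rightarrow> ('g \<Rightarrow> 'v) \<Rightarrow> ('g \<times> nat) list \<Rightarrow> 'v"
  where
    "monomial V x [] = vacuum V"
  | "monomial V x (a # w) = nprod V (x (fst a)) (- int (snd a)) (monomial V x w)"

definition lin_comb ::
    "('v::comm_monoid_add, 'm) vertex_structure_scheme \<Rightarrow> ('i \<Rightarrow> 'v) \<Rightarrow> ('i \<Rightarrow>\<^sub>0 complex) \<Rightarrow> 'v"
  where "lin_comb V y f = (\<Sum>b\<in>Poly_Mapping.keys f. smul V (Poly_Mapping.lookup f b) (y b))"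

text \<open>\<open>V\<close> with the vectors \<open>x g\<close> is the universal affine vertex superalgebra of
  \<open>\<gg>\<close> and the bilinear form \<open>\<kappa>\<close>: the OPE assumptions say
  \<open>u(z)v(w) ~ [u,v](w)/(z-w) + \<kappa>(u,v)/(z-w)\<^sup>2\<close>, and the last two assumptions say that
  \<open>U(t\<^sup>-\<^sup>1\<gg>[t\<^sup>-\<^sup>1]) \<rightarrow> V\<close>, sending a word to its \<open>monomial\<close>, is a
  well-defined linear bijection.\<close>

locale universal_affine = vertex_superalgebra V
  for V :: "'v::ab_group_add vertex_structure" (structure) +
  fixes B :: "'g set" and od :: "'g \<Rightarrow> bool" and br :: "'g \<Rightarrow> 'g \<Rightarrow> 'g \<Rightarrow>\<^sub>0 complex"
    and \<kappa> :: "'g \<Rightarrow> 'g \<Rightarrow> complex" and x :: "'g \<Rightarrow> 'v"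
  assumes gen_parity: "g \<in> B \<Longrightarrow> x g \<in> parity V (od g)"
    and ope_0: "g \<in> B \<Longrightarrow> h \<in> B \<Longrightarrow> x g \<langle>0\<rangle> x h = lin_comb V x (br g h)"
    and ope_1: "g \<in> B \<Longrightarrow> h \<in> B \<Longrightarrow> x g \<langle>1\<rangle> x h = \<kappa> g h \<odot> \<Omega>"
    and ope_ge_2: "g \<in> B \<Longrightarrow> h \<in> B \<Longrightarrow> s \<ge> 2 \<Longrightarrow> x g \<langle>s\<rangle> x h = 0"
    and spanning: "span (monomial V x ` words B) = UNIV"
    and relations: "Poly_Mapping.keys f \<subseteq> words B \<Longrightarrow>
          lin_comb V (monomial V x) f = 0 \<longleftrightarrow> f \<in> enveloping_ideal B od br"


section \<open>The Lie superalgebra of the pyramid of type $(2^n,1^{m-n})$\<close>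

definition col :: "nat \<Rightarrow> nat \<Rightarrow> nat"
  where "col m i = (if i \<le> m then 1 else 2)"

definition row :: "nat \<Rightarrow> nat \<Rightarrow> nat \<Rightarrow> nat"
  where "row m n i = (if i \<le> m then i else i - n)"

text \<open>\<open>E i j\<close> and \<open>Psi i j\<close> are the symbols \<open>e\<^bsub>i,j\<^esub>\<close> and
  \<open>\<psi>\<^bsub>i,j\<^esub>\<close>; only those with indices in the ranges below are basis elements.\<close>

datatype gen = E nat nat | Psi nat nat

definition b_basis :: "nat \<Rightarrow> nat \<Rightarrow> gen set"
  where "b_basis m n = {E i j |i j. i \<in> {1..m + n} \<and> j \<in> {1..m + n} \<and> col m i \<ge> col m j}"

definition a_basis :: "nat \<Rightarrow> nat \<Rightarrow> gen set"
  where "a_basis m n = b_basis m n \<union>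
    {Psi i j |i j. i \<in> {1..m + n} \<and> j \<in> {1..m + n} \<and> col m i > col m j}"

fun is_psi :: "gen \<Rightarrow> bool"
  where
    "is_psi (E i j) = False"
  | "is_psi (Psi i j) = True"

text \<open>For arguments in \<open>a_basis m n\<close> all symbols with nonzero coefficient on the
  right-hand sides lie in \<open>a_basis m n\<close> again.\<close>

fun bracket :: "gen \<Rightarrow> gen \<Rightarrow> gen \<Rightarrow>\<^sub>0 complex"
  where
    "bracket (E i j) (E p q) =
       Poly_Mapping.single (E i q) (of_bool (j = p)) - Poly_Mapping.single (E p j) (of_bool (i = q))"
  | "bracket (E i j) (Psi p q) =
       Poly_Mapping.single (Psi i q) (of_bool (j = p)) - Poly_Mapping.single (Psi p j) (of_bool (i = q))"
  | "bracket (Psi p q) (E i j) =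
       Poly_Mapping.single (Psi p j) (of_bool (i = q)) - Poly_Mapping.single (Psi i q) (of_bool (j = p))"
  | "bracket (Psi i j) (Psi p q) = 0"

fun form :: "nat \<Rightarrow> complex \<Rightarrow> complex \<Rightarrow> gen \<Rightarrow> gen \<Rightarrow> complex"
  where
    "form m \<alpha>\<^sub>1 \<alpha>\<^sub>2 (E i j) (E p q) =
       (if i \<le> m \<and> j \<le> m \<and> p \<le> m \<and> q \<le> m
        then \<alpha>\<^sub>1 * of_bool (i = q \<and> p = j) + of_bool (i = j \<and> p = q)
        else if m < i \<and> m < j \<and> m < p \<and> m < q
        then \<alpha>\<^sub>2 * of_bool (i = q \<and> p = j) + of_bool (i = j \<and> p = q)
        else 0)"
  | "form m \<alpha>\<^sub>1 \<alpha>\<^sub>2 (E i j) (Psi p q) = 0"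
  | "form m \<alpha>\<^sub>1 \<alpha>\<^sub>2 (Psi i j) g = 0"


section \<open>The W-algebra\<close>

text \<open>\<open>V_b V m n x\<close> is the subspace \<open>U(t\<^sup>-\<^sup>1\<bb>[t\<^sup>-\<^sup>1])\<close> of
  \<open>U(t\<^sup>-\<^sup>1\<aa>[t\<^sup>-\<^sup>1])\<close>, that is, the vertex algebra
  \<open>V\<^sup>\<kappa>(\<bb>)\<close> inside \<open>V\<close>.\<close>

definition V_b :: "'v::ab_group_add vertex_structure \<Rightarrow> nat \<Rightarrow> nat \<Rightarrow> (gen \<Rightarrow> 'v) \<Rightarrow> 'v set"
  where "V_b V m n x = module.span (smul V) (monomial V x ` words (b_basis m n))"

text \<open>In the last assumption, \<open>\<psi>\<close> with index \<open>i + n\<close> (the hat of \<open>i\<close>) occurs for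
  \<open>m - n < i \<le> m\<close>, and \<open>\<psi>\<close> with index \<open>j - n\<close> (the tilde of \<open>j\<close>) for
  \<open>m < j\<close>; the remaining conditions on \<open>i\<close> and \<open>j\<close> ensuring that these
  \<open>\<psi>\<close> are in range hold automatically for elements of \<open>\<bb>\<close>. There are no signs in
  \<open>d_nprod\<close> because \<open>V\<^sup>\<kappa>(\<bb>)\<close> is purely even. Nothing is assumed
  about \<open>d\<close> outside \<open>V\<^sup>\<kappa>(\<bb>)\<close>.\<close>

locale W_differential =
  fixes V :: "'v::ab_group_add vertex_structure" (structure)
    and m n :: nat and \<alpha>\<^sub>2 :: complex and x :: "gen \<Rightarrow> 'v" and d :: "'v \<Rightarrow> 'v"
  assumes d_add: "u \<in> V_b V m n x \<Longrightarrow> v \<in> V_b V m n x \<Longrightarrow> d (u + v) = d u + d v"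
    and d_smul: "u \<in> V_b V m n x \<Longrightarrow> d (c \<odot> u) = c \<odot> d u"
    and d_odd: "u \<in> V_b V m n x \<Longrightarrow> d u \<in> parity V True"
    and d_nprod: "u \<in> V_b V m n x \<Longrightarrow> v \<in> V_b V m n x \<Longrightarrow>
                    d (u \<langle>s\<rangle> v) = d u \<langle>s\<rangle> v + u \<langle>s\<rangle> d v"
    and d_vacuum: "d \<Omega> = 0"
    and d_transl: "u \<in> V_b V m n x \<Longrightarrow> d (\<partial> u) = \<partial> (d u)"
    and d_gen: "E i j \<in> b_basis m n \<Longrightarrow>
      d (x (E i j)) =
        (\<Sum>r\<in>{r\<in>{1..m + n}. col m i > col m r \<and> col m r \<ge> col m j}. x (E r j) \<langle>- 1\<rangle> x (Psi i r))
        - (\<Sum>r\<in>{r\<in>{1..m + n}. col m j < col m r \<and> col m r \<le> col m i}. x (Psi r j) \<langle>- 1\<rangle> x (E i r))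
        + (if col m i > col m j then \<alpha>\<^sub>2 \<odot> (x (Psi i j) \<langle>- 2\<rangle> \<Omega>) else 0)
        + (if m - n < i \<and> i \<le> m then x (Psi (i + n) j) else 0)
        - (if m < j then x (Psi i (j - n)) else 0)"

definition W_algebra ::
    "'v::ab_group_add vertex_structure \<Rightarrow> nat \<Rightarrow> nat \<Rightarrow> (gen \<Rightarrow> 'v) \<Rightarrow> ('v \<Rightarrow> 'v) \<Rightarrow> 'v set"
  where "W_algebra V m n x d = {y \<in> V_b V m n x. d y = 0}"

text \<open>The elements \<open>W\<^bsup>(1)\<^esup>\<^bsub>i,j\<^esub>\<close> and \<open>W\<^bsup>(2)\<^esup>\<^bsub>i,j\<^esub>\<close>.
  The formulas make sense for all \<open>i\<close> and \<open>j\<close>, but are meaningful only in the ranges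
  given by \<open>W1_range\<close> and by \<open>m - n < i \<le> m\<close>, \<open>1 \<le> j \<le> m\<close>,
  respectively.\<close>

definition W1_range :: "nat \<Rightarrow> nat \<Rightarrow> (nat \<times> nat) set"
  where "W1_range m n = {1..m - n} \<times> {1..m} \<union> {m - n<..m} \<times> {m - n<..m}"

definition W1_elem ::
    "'v::ab_group_add vertex_structure \<Rightarrow> nat \<Rightarrow> nat \<Rightarrow> (gen \<Rightarrow> 'v) \<Rightarrow> nat \<Rightarrow> nat \<Rightarrow> 'v"
  where "W1_elem V m n x i j =
    (\<Sum>(h, l)\<in>{(h, l). h \<in> {1..m + n} \<and> l \<in> {1..m + n} \<and>
        row m n h = i \<and> row m n l = j \<and> col m h = col m l}. x (E h l))"

definition W2_elem ::
    "'v::ab_group_add vertex_structure \<Rightarrow> nat \<Rightarrow> nat \<Rightarrow> complex \<Rightarrow> (gen \<Rightarrow> 'v) \<Rightarrow> nat \<Rightarrow> nat \<Rightarrow> 'v"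
  where "W2_elem V m n \<alpha>\<^sub>2 x i j =
    x (E (i + n) j) - smul V \<alpha>\<^sub>2 (nprod V (x (E i j)) (- 2) (vacuum V))
    + (\<Sum>u\<in>{m - n<..m}. nprod V (x (E u j)) (- 1) (x (E (i + n) (u + n))))
    - (\<Sum>u\<in>{1..m - n}. nprod V (x (E u j)) (- 1) (x (E i u)))"

abbreviation delta :: "bool \<Rightarrow> complex"  (\<open>\<delta>\<close>)
  where "\<delta> P \<equiv> of_bool P"

end

theory Submission
  imports Defs
begin

text \<open>The commutator formula determines the nonnegative modes of the generators $a$, $b$, $c$ of the
  blocks on $W^{(2)}_{i,j}$. Since $W^{(2)}_{p,q}$ is a sum of normally ordered products of at most two
  generators, the products $(W^{(2)}_{p,q})_{(s)} W^{(2)}_{i,j}$ follow from these by expanding one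
  factor at a time. Both sides of each formula become linear combinations of ordered monomials in the
  negative modes; their coefficients agree because $m - n = \alpha_2 - \alpha_1$.\<close>

section \<open>Products in vertex superalgebras\<close>

text \<open>The sizes \<open>m\<close>, \<open>n\<close> and all row indices are symbolic, so no sum
  over rows can be evaluated: noncommutative words under such sums must reach a normal form by
  rewriting alone. Two features make this finite. By conformal weight, \<open>W2\<close> having
  weight 2, the s-th product has weight 3 - s, every generator mode from 3 on annihilates
  \<open>W2\<close>, and each iterated product has only a few terms. The two levels mix through
  contractions. A Kronecker delta with the summation row collapses a sum over the rows with one box,
  whereas a delta that becomes trivial inside such a sum leaves a factor m - n, the number of these
  rows. Thus the derivative term of \<open>W2\<close> contributes \<open>\<alpha>\<^sub>2\<close>, a
  double contraction subtracts m - n, and \<open>\<alpha>\<^sub>1\<close> appears in front of terms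
  that no form on the first block has produced. All product formulas are identities in the ambient
  affine vertex superalgebra. The differential enters only in the proof that \<open>W1\<close> and
  \<open>W2\<close> lie in its kernel.\<close>

context vertex_superalgebra
begin

lemma nprod_zero_left [simp]: "0 \<langle>s\<rangle> v = 0"
  using nprod_add_left[of 0 0 s v] by simp

lemma nprod_zero_right [simp]: "u \<langle>s\<rangle> 0 = 0"
  using nprod_add_right[of u s 0 0] by simp

lemma nprod_uminus_left: "(- u) \<langle>s\<rangle> v = - (u \<langle>s\<rangle> v)"
  by (metis scale_minus_left scale_one nprod_smul_left)

lemma nprod_uminus_right: "u \<langle>s\<rangle> (- v) = - (u \<langle>s\<rangle> v)"
  by (metis scale_minus_left scale_one nprod_smul_right)

lemma nprod_diff_left: "(u - u') \<langle>s\<rangle> v = u \<langle>s\<rangle> v - u' \<langle>s\<rangle> v"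
  using nprod_add_left[of u "- u'" s v] by (simp add: nprod_uminus_left)

lemma nprod_diff_right: "u \<langle>s\<rangle> (v - v') = u \<langle>s\<rangle> v - u \<langle>s\<rangle> v'"
  using nprod_add_right[of u s v "- v'"] by (simp add: nprod_uminus_right)

lemma nprod_sum_left: "(\<Sum>i\<in>S. f i) \<langle>s\<rangle> v = (\<Sum>i\<in>S. f i \<langle>s\<rangle> v)"
  by (induction S rule: infinite_finite_induct) (auto simp: nprod_add_left)

lemma nprod_sum_right: "u \<langle>s\<rangle> (\<Sum>i\<in>S. f i) = (\<Sum>i\<in>S. u \<langle>s\<rangle> f i)"
  by (induction S rule: infinite_finite_induct) (auto simp: nprod_add_right)

section \<open>Special cases of the Borcherds identity\<close>

lemma truncation3:
  obtains K where "\<And>t. t \<ge> K \<Longrightarrow> u \<langle>l + int t\<rangle> v = 0 \<and> v \<langle>s + int t\<rangle> w = 0 \<and> u \<langle>r + int t\<rangle> w = 0"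
proof -
  have *: "\<exists>K. \<forall>t\<ge>K. y \<langle>a + int t\<rangle> z = 0" for y z a
  proof -
    obtain K :: nat where K: "\<forall>s\<ge>int K. y \<langle>s\<rangle> z = 0"
      using truncation by blast
    \<comment> \<open>The offset \<open>a\<close> may be negative; adding its absolute value to the
      cutoff compensates for that.\<close>
    then have "\<forall>t\<ge>K + nat \<bar>a\<bar>. y \<langle>a + int t\<rangle> z = 0"
      by auto
    then show ?thesis ..
  qed
  obtain K1 K2 K3 where "\<forall>t\<ge>K1. u \<langle>l + int t\<rangle> v = 0" "\<forall>t\<ge>K2. v \<langle>s + int t\<rangle> w = 0"
    "\<forall>t\<ge>K3. u \<langle>r + int t\<rangle> w = 0"
    using * by meson
  then show ?thesis
    by (intro that[of "K1 + K2 + K3"]) auto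
qed

lemma sum_lessThan_first:
  fixes f :: "nat \<Rightarrow> 'v"
  assumes "\<And>t. t \<ge> M \<Longrightarrow> f t = 0" "M \<le> K"
  shows "(\<Sum>t<K. f t) = (\<Sum>t<M. f t)"
  using assms by (intro sum.mono_neutral_right) auto

text \<open>This is the Borcherds identity at l = 0: there \<open>0 gchoose t\<close> kills every
  term on the right except t = 0. The bound \<open>M\<close> concerns only the products of
  \<open>u\<close> with \<open>v\<close>, so it does not depend on \<open>w\<close>.\<close>

lemma commutator:
  assumes "u \<in> parity V False" "v \<in> parity V False"
    and M: "\<And>t. t \<ge> M \<Longrightarrow> u \<langle>int t\<rangle> v = 0"
  shows "u \<langle>r\<rangle> (v \<langle>s\<rangle> w) =
    v \<langle>s\<rangle> (u \<langle>r\<rangle> w) + (\<Sum>t<M. (of_int r gchoose t) \<odot> ((u \<langle>int t\<rangle> v) \<langle>r + s - int t\<rangle> w))"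
proof -
  obtain K where K: "\<And>t. t \<ge> K \<Longrightarrow> u \<langle>0 + int t\<rangle> v = 0 \<and> v \<langle>s + int t\<rangle> w = 0 \<and> u \<langle>r + int t\<rangle> w = 0"
    using truncation3 by blast
  \<comment> \<open>\<open>Suc\<close> keeps the term t = 0 in range even if \<open>K\<close> and
    \<open>M\<close> are zero; adding \<open>M\<close> makes the sum long enough to be cut back to
    \<open>M\<close> terms.\<close>
  define L where "L = Suc (K + M)"
  have *: "\<And>t. t \<ge> L \<Longrightarrow> u \<langle>0 + int t\<rangle> v = 0 \<and> v \<langle>s + int t\<rangle> w = 0 \<and> u \<langle>r + int t\<rangle> w = 0"
    using K unfolding L_def by auto
  have "(\<Sum>t<M. (of_int r gchoose t) \<odot> ((u \<langle>int t\<rangle> v) \<langle>r + s - int t\<rangle> w)) =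
      (\<Sum>t<L. (of_int r gchoose t) \<odot> ((u \<langle>0 + int t\<rangle> v) \<langle>r + s - int t\<rangle> w))"
    using M unfolding L_def by (subst sum_lessThan_first[where M = M]) auto
  also have "\<dots> = (\<Sum>t<L. ((- 1) ^ t * (of_int 0 gchoose t)) \<odot>
          (u \<langle>r + 0 - int t\<rangle> (v \<langle>s + int t\<rangle> w)
           - ((if False \<and> False then - 1 else 1) * (- 1) powi 0) \<odot>
               (v \<langle>s + 0 - int t\<rangle> (u \<langle>r + int t\<rangle> w))))"
    by (rule borcherds[OF assms(1,2) *])
  also have "\<dots> = u \<langle>r\<rangle> (v \<langle>s\<rangle> w) - v \<langle>s\<rangle> (u \<langle>r\<rangle> w)"
    unfolding L_def by (subst sum_lessThan_first[where M = 1]) (auto simp: gbinomial_0_left)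
  finally show ?thesis
    by simp
qed

text \<open>This is the Borcherds identity at r = 0. An even \<open>u\<close> makes the sign
  trivial, so \<open>v\<close> may have either parity; the odd case is needed for the derivation
  rule of the translation operator.\<close>

lemma nprod_nprod_left:
  assumes "u \<in> parity V False" "v \<in> parity V b"
    and M: "\<And>t. t \<ge> M \<Longrightarrow> v \<langle>s + int t\<rangle> w = 0" "\<And>t. t \<ge> M \<Longrightarrow> u \<langle>int t\<rangle> w = 0"
  shows "(u \<langle>l\<rangle> v) \<langle>s\<rangle> w = (\<Sum>t<M. ((- 1) ^ t * (of_int l gchoose t)) \<odot>
    (u \<langle>l - int t\<rangle> (v \<langle>s + int t\<rangle> w) - ((- 1) powi l) \<odot> (v \<langle>s + l - int t\<rangle> (u \<langle>int t\<rangle> w))))"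
proof -
  obtain K where K: "\<And>t. t \<ge> K \<Longrightarrow> u \<langle>l + int t\<rangle> v = 0 \<and> v \<langle>s + int t\<rangle> w = 0 \<and> u \<langle>0 + int t\<rangle> w = 0"
    using truncation3 by blast
  define L where "L = Suc (K + M)"
  have *: "\<And>t. t \<ge> L \<Longrightarrow> u \<langle>l + int t\<rangle> v = 0 \<and> v \<langle>s + int t\<rangle> w = 0 \<and> u \<langle>0 + int t\<rangle> w = 0"
    using K unfolding L_def by auto
  have "(u \<langle>l\<rangle> v) \<langle>s\<rangle> w =
      (\<Sum>t<L. (of_int 0 gchoose t) \<odot> ((u \<langle>l + int t\<rangle> v) \<langle>0 + s - int t\<rangle> w))"
    unfolding L_def by (subst sum_lessThan_first[where M = 1]) (auto simp: gbinomial_0_left)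
  also have "\<dots> = (\<Sum>t<L. ((- 1) ^ t * (of_int l gchoose t)) \<odot>
          (u \<langle>0 + l - int t\<rangle> (v \<langle>s + int t\<rangle> w)
           - ((if False \<and> b then - 1 else 1) * (- 1) powi l) \<odot>
               (v \<langle>s + l - int t\<rangle> (u \<langle>0 + int t\<rangle> w))))"
    by (rule borcherds[OF assms(1,2) *])
  also have "\<dots> = (\<Sum>t<M. ((- 1) ^ t * (of_int l gchoose t)) \<odot>
    (u \<langle>l - int t\<rangle> (v \<langle>s + int t\<rangle> w) - ((- 1) powi l) \<odot> (v \<langle>s + l - int t\<rangle> (u \<langle>int t\<rangle> w))))"
    using M unfolding L_def by (subst sum_lessThan_first[where M = M]) auto
  finally show ?thesis .
qed

text \<open>At l = -1 each alternating binomial coefficient equals 1, and the factor (-1)^(-1) turns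
  the difference of the two families into a sum.\<close>

lemma nprod_normal_ordered:
  assumes "u \<in> parity V False" "v \<in> parity V False"
    and "\<And>t. t \<ge> M \<Longrightarrow> v \<langle>s + int t\<rangle> w = 0" "\<And>t. t \<ge> M \<Longrightarrow> u \<langle>int t\<rangle> w = 0"
  shows "(u \<langle>- 1\<rangle> v) \<langle>s\<rangle> w =
    (\<Sum>t<M. u \<langle>- 1 - int t\<rangle> (v \<langle>s + int t\<rangle> w) + v \<langle>s - 1 - int t\<rangle> (u \<langle>int t\<rangle> w))"
proof -
  have "(- 1) ^ t * (of_int (- 1) gchoose t) = (1 :: complex)" for t
    by (simp add: gbinomial_minus binomial_gbinomial[symmetric] flip: power_mult_distrib)
  then have "(u \<langle>- 1\<rangle> v) \<langle>s\<rangle> w = (\<Sum>t<M. 1 \<odot>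
      (u \<langle>- 1 - int t\<rangle> (v \<langle>s + int t\<rangle> w) - ((- 1) powi (- 1)) \<odot> (v \<langle>s + - 1 - int t\<rangle> (u \<langle>int t\<rangle> w))))"
    using nprod_nprod_left[OF assms(1,2), of M s w "- 1"] assms(3,4) by simp
  then show ?thesis
    by simp
qed

text \<open>With the vacuum as second factor of the iterated product, only its mode -1 survives.
  Hence one term remains, from the first family if s < 0 and from the second if s > 0, and none if s
  = 0.\<close>

lemma transl_nprod_left:
  assumes "u \<in> parity V False"
  shows "(\<partial> u) \<langle>s\<rangle> w = of_int (- s) \<odot> (u \<langle>s - 1\<rangle> w)"
proof -
  obtain K0 :: nat where K0: "\<forall>s\<ge>int K0. u \<langle>s\<rangle> w = 0"
    using truncation by blast
  define K where "K = Suc (K0 + nat \<bar>s\<bar>)"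
  have K: "u \<langle>int t\<rangle> w = 0" "\<Omega> \<langle>s + int t\<rangle> w = 0" if "t \<ge> K" for t
    using that K0 unfolding K_def by (auto simp: vacuum_left)
  \<comment> \<open>These are the coefficients t + 1 of the expansion of (1 - z)^(-2).\<close>
  have g: "(- 1) ^ t * ((- 2) gchoose t) = (of_nat (Suc t) :: complex)" for t
  proof -
    have "(- 2 gchoose t :: complex) = (- 1) ^ t * (of_nat (Suc t) gchoose t)"
      by (simp add: gbinomial_minus algebra_simps)
    also have "(of_nat (Suc t) gchoose t :: complex) = of_nat (Suc t)"
      by (metis binomial_Suc_n binomial_gbinomial)
    finally show ?thesis
      by (simp flip: power_mult_distrib mult.assoc)
  qed
  let ?f = "\<lambda>t. of_nat (Suc t) \<odot> (u \<langle>- 2 - int t\<rangle> w)" and ?g = "\<lambda>t. of_nat (Suc t) \<odot> (u \<langle>int t\<rangle> w)"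
  have "(\<partial> u) \<langle>s\<rangle> w = (\<Sum>t<K. ((- 1) ^ t * (of_int (-2) gchoose t)) \<odot>
      (u \<langle>-2 - int t\<rangle> (\<Omega> \<langle>s + int t\<rangle> w) - (\<Omega> \<langle>s + - 2 - int t\<rangle> (u \<langle>int t\<rangle> w))))"
    unfolding transl_def
    by (subst nprod_nprod_left[OF assms vacuum_even K(2) K(1)]) auto
  also have "\<dots> = (\<Sum>t<K. (if t = nat (- 1 - s) then if s \<le> - 1 then ?f t else 0 else 0)
      - (if t = nat (s - 1) then if s \<ge> 1 then ?g t else 0 else 0))"
    using g by (intro sum.cong) (auto simp: vacuum_left)
  also have "\<dots> = (if s \<le> - 1 then ?f (nat (- 1 - s)) else 0) - (if s \<ge> 1 then ?g (nat (s - 1)) else 0)"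
  proof -
    have "nat (- 1 - s) < K" "nat (s - 1) < K"
      by (auto simp: K_def)
    then show ?thesis
      by (simp only: sum_subtractf sum.delta finite_lessThan lessThan_iff if_True)
  qed
  also have "\<dots> = of_int (- s) \<odot> (u \<langle>s - 1\<rangle> w)"
  proof -
    consider (neg) "s \<le> - 1" | (zero) "s = 0" | (pos) "s \<ge> 1"
      by linarith
    then show ?thesis
    proof cases
      case neg
      then have "(of_nat (Suc (nat (- 1 - s))) :: complex) = of_int (- s)"
          "- 2 - int (nat (- 1 - s)) = s - 1"
        by (simp_all add: of_nat_nat)
      moreover have "\<not> s \<ge> 1"
        using neg by simp
      ultimately show ?thesis
        using neg by (simp only: if_True if_False diff_zero)
    next
      case pos
      then have "(of_nat (Suc (nat (s - 1))) :: complex) = of_int s" "int (nat (s - 1)) = s - 1"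
        by (simp_all add: of_nat_nat)
      moreover have "\<not> s \<le> - 1"
        using pos by simp
      ultimately show ?thesis
        using pos by (simp only: if_True if_False diff_0 of_int_minus scale_minus_left)
    qed simp
  qed
  finally show ?thesis .
qed

lemma transl_nprod:
  assumes "u \<in> parity V False"
  shows "\<partial> (u \<langle>s\<rangle> v) = (\<partial> u) \<langle>s\<rangle> v + u \<langle>s\<rangle> (\<partial> v)"
proof -
  have *: "\<partial> (u \<langle>s\<rangle> v) = (\<partial> u) \<langle>s\<rangle> v + u \<langle>s\<rangle> (\<partial> v)" if v: "v \<in> parity V b" for v b
  proof -
    \<comment> \<open>Two terms suffice because nonnegative modes kill the vacuum. The term t = 1 is
      the derivative of the left factor, written as -s times a product with index s - 1.\<close>
    have "(u \<langle>s\<rangle> v) \<langle>- 2\<rangle> \<Omega> = (\<Sum>t<2. ((- 1) ^ t * (of_int s gchoose t)) \<odot>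
      (u \<langle>s - int t\<rangle> (v \<langle>- 2 + int t\<rangle> \<Omega>) - ((- 1) powi s) \<odot> (v \<langle>- 2 + s - int t\<rangle> (u \<langle>int t\<rangle> \<Omega>))))"
      using assms v by (intro nprod_nprod_left) (auto simp: vacuum_right_nonneg)
    also have "\<dots> = u \<langle>s\<rangle> (v \<langle>- 2\<rangle> \<Omega>) - of_int s \<odot> (u \<langle>s - 1\<rangle> v)"
      by (simp add: numeral_2_eq_2 vacuum_right_nonneg vacuum_right)
    finally show ?thesis
      using transl_nprod_left[OF assms, of s v] by (simp add: transl_def)
  qed
  obtain y z where "v = y + z" "y \<in> parity V False" "z \<in> parity V True"
    using parity_sum by blast
  then show ?thesis
    using *[of y False] *[of z True] by (simp add: transl_def nprod_add_left nprod_add_right)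
qed

lemma transl_add: "\<partial> (u + v) = \<partial> u + \<partial> v"
  and transl_diff: "\<partial> (u - v) = \<partial> u - \<partial> v"
  and transl_smul: "\<partial> (c \<odot> u) = c \<odot> \<partial> u"
  and transl_sum: "\<partial> (\<Sum>i\<in>S. f i) = (\<Sum>i\<in>S. \<partial> (f i))"
  by (simp_all add: transl_def nprod_add_left nprod_diff_left nprod_smul_left nprod_sum_left)

lemma transl_zero [simp]: "\<partial> 0 = 0"
  by (simp add: transl_def)

lemma transl_vacuum [simp]: "\<partial> \<Omega> = 0"
  by (simp add: transl_def vacuum_left)

text \<open>Vector identities are checked on all linear functionals: this turns them into identities
  between complex numbers, where commutative ring normalization is available.\<close>

definition functional :: "('v \<Rightarrow> complex) \<Rightarrow> bool"
  where "functional \<phi> \<longleftrightarrow> (\<forall>u v. \<phi> (u + v) = \<phi> u + \<phi> v) \<and> (\<forall>c u. \<phi> (c \<odot> u) = c * \<phi> u)"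

text \<open>Coordinates with respect to a Hamel basis are functionals, and together they determine
  the vector.\<close>

lemma eq_by_functionals:
  assumes "\<And>\<phi>. functional \<phi> \<Longrightarrow> \<phi> u = \<phi> v"
  shows "u = v"
proof -
  define B where "B = extend_basis {}"
  have B: "independent B" "span B = UNIV"
    by (simp_all add: B_def independent_extend_basis independent_empty span_extend_basis)
  have "functional (\<lambda>u. representation B u b)" for b
    using B by (simp add: functional_def representation_add representation_scale)
  then have eq: "representation B u = representation B v"
    using assms by blast
  have *: "(\<Sum>b | representation B w b \<noteq> 0. representation B w b \<odot> b) = w" for w
    by (rule sum_nonzero_representation_eq) (simp_all add: B)
  show ?thesis
    using trans[OF sym[OF *[of u, unfolded eq]] *[of v]] .
qed

lemma
  assumes "functional \<phi>"
  shows functional_add: "\<phi> (u + v) = \<phi> u + \<phi> v"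
    and functional_smul: "\<phi> (c \<odot> u) = c * \<phi> u"
    and functional_zero: "\<phi> 0 = 0"
    and functional_uminus: "\<phi> (- u) = - \<phi> u"
    and functional_diff: "\<phi> (u - v) = \<phi> u - \<phi> v"
    and functional_sum: "\<phi> (\<Sum>i\<in>S. f i) = (\<Sum>i\<in>S. \<phi> (f i))"
proof -
  show add: "\<phi> (u + v) = \<phi> u + \<phi> v" for u v
    using assms by (simp add: functional_def)
  show smul: "\<phi> (c \<odot> u) = c * \<phi> u" for c u
    using assms by (simp add: functional_def)
  show zero: "\<phi> 0 = 0"
    using smul[of 0 0] by simp
  show uminus: "\<phi> (- u) = - \<phi> u" for u
    using add[of u "- u"] zero by (simp add: eq_neg_iff_add_eq_0 add.commute)
  show "\<phi> (u - v) = \<phi> u - \<phi> v"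
    using add[of u "- v"] uminus[of v] by simp
  show "\<phi> (\<Sum>i\<in>S. f i) = (\<Sum>i\<in>S. \<phi> (f i))"
    by (induction S rule: infinite_finite_induct) (simp_all add: add zero)
qed

end

section \<open>Modes of the generators\<close>

lemma (in vertex_superalgebra) lin_comb_single [simp]:
  "lin_comb V y (Poly_Mapping.single b c) = c \<odot> y b"
  by (simp add: lin_comb_def)

text \<open>Cancellation can shrink the support of a difference, so all three sums are taken over
  the union of the supports.\<close>

lemma (in vertex_superalgebra) lin_comb_diff:
  "lin_comb V y (f - g) = lin_comb V y f - lin_comb V y g"
proof -
  let ?S = "Poly_Mapping.keys f \<union> Poly_Mapping.keys g"
  have *: "lin_comb V y h = (\<Sum>b\<in>?S. Poly_Mapping.lookup h b \<odot> y b)" if "Poly_Mapping.keys h \<subseteq> ?S" for h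
    unfolding lin_comb_def using that by (intro sum.mono_neutral_left) (auto simp: in_keys_iff)
  have "Poly_Mapping.keys (f - g) \<subseteq> ?S"
    by (auto simp: in_keys_iff lookup_minus)
  then show ?thesis
    by (simp add: * lookup_minus scale_left_diff_distrib sum_subtractf)
qed

context universal_affine
begin

lemma gen_nprod_ge:
  assumes "g \<in> B" "h \<in> B" "t \<ge> 2"
  shows "x g \<langle>int t\<rangle> x h = 0"
  using ope_ge_2[OF assms(1,2)] assms(3) by simp

text \<open>The OPE has poles of order at most two. The double pole contributes r times the form
  times the vacuum mode r + s - 1, which is the identity exactly when r + s = 0.\<close>

lemma gen_commutator:
  assumes "g \<in> B" "h \<in> B" "\<not> od g" "\<not> od h"
  shows "x g \<langle>r\<rangle> (x h \<langle>s\<rangle> w) = x h \<langle>s\<rangle> (x g \<langle>r\<rangle> w) + lin_comb V x (br g h) \<langle>r + s\<rangle> w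
    + (if r + s = 0 then (of_int r * \<kappa> g h) \<odot> w else 0)"
proof -
  have "x g \<langle>r\<rangle> (x h \<langle>s\<rangle> w) = x h \<langle>s\<rangle> (x g \<langle>r\<rangle> w) +
      (\<Sum>t<2. (of_int r gchoose t) \<odot> ((x g \<langle>int t\<rangle> x h) \<langle>r + s - int t\<rangle> w))"
    using gen_parity[OF assms(1)] gen_parity[OF assms(2)] assms gen_nprod_ge
    by (intro commutator) auto
  then show ?thesis
    using assms by (simp add: numeral_2_eq_2 ope_0 ope_1 nprod_smul_left vacuum_left)
qed

end

section \<open>Rows, blocks and modes of the pyramid\<close>

locale pyramid_affine =
  universal_affine V "a_basis m n" is_psi bracket "form m \<alpha>\<^sub>1 \<alpha>\<^sub>2" x
  for V :: "'v::ab_group_add vertex_structure" (structure)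
    and m n :: nat and \<alpha>\<^sub>1 \<alpha>\<^sub>2 :: complex and x :: "gen \<Rightarrow> 'v" +
  assumes n_le_m: "n \<le> m"
    and level_diff: "of_nat (m - n) = \<alpha>\<^sub>2 - \<alpha>\<^sub>1"
begin

text \<open>\<open>guard\<close> stands for a Kronecker delta. It is a constant because rewriting does not enter the
  branches of a conditional.\<close>

definition guard :: "bool \<Rightarrow> 'v \<Rightarrow> 'v"
  where "guard P v = (if P then v else 0)"

lemma guard_simps [simp]:
  "guard True v = v" "guard False v = 0" "guard P 0 = 0"
  by (simp_all add: guard_def)

lemma guard_linear:
  "guard P (u + v) = guard P u + guard P v" "guard P (u - v) = guard P u - guard P v"
  "guard P (- u) = - guard P u" "c \<odot> guard P u = guard P (c \<odot> u)"
  by (simp_all add: guard_def)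

lemma sum_guard:
  fixes f :: "nat \<Rightarrow> 'v"
  shows "(\<Sum>u\<in>S. guard P (f u)) = guard P (\<Sum>u\<in>S. f u)"
    and "finite S \<Longrightarrow> (\<Sum>u\<in>S. guard (u = w) (f u)) = guard (w \<in> S) (f w)"
    and "finite S \<Longrightarrow> (\<Sum>u\<in>S. guard (w = u) (f u)) = guard (w \<in> S) (f w)"
  by (simp_all add: guard_def)

text \<open>\<open>I1\<close> consists of the rows with one box, \<open>I2\<close> of those with
  two. Adding \<open>n\<close> to a row in \<open>I2\<close> gives the index of its box in the
  second column.\<close>

definition "I = {1..m}"
definition "I1 = {1..m - n}"
definition "I2 = {m - n<..m}"

lemma index_sets [simp]:
  "finite I1" "finite I2" "u \<in> I1 \<Longrightarrow> u \<in> I" "u \<in> I2 \<Longrightarrow> u \<in> I" "u \<in> I1 \<Longrightarrow> u \<notin> I2"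
  by (auto simp: I_def I1_def I2_def)

lemma index_cases: "u \<in> I \<Longrightarrow> u \<in> I1 \<and> u \<notin> I2 \<or> u \<in> I2 \<and> u \<notin> I1"
  by (auto simp: I_def I1_def I2_def)

lemma index_neq [simp]:
  "u \<in> I1 \<Longrightarrow> w \<in> I2 \<Longrightarrow> u \<noteq> w" "u \<in> I1 \<Longrightarrow> w \<in> I2 \<Longrightarrow> w \<noteq> u"
  by (auto simp: I1_def I2_def)

text \<open>This rewrites the number of rows with one box, left over by a contracted sum, in terms
  of the levels, so that coefficients can be compared as polynomials in
  \<open>\<alpha>\<^sub>1\<close> and \<open>\<alpha>\<^sub>2\<close>.\<close>

lemma card_I1: "of_nat (card I1) = \<alpha>\<^sub>2 - \<alpha>\<^sub>1"
  by (simp add: I1_def level_diff)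

text \<open>\<open>am i j s\<close>, \<open>bm i j s\<close>, \<open>cm i j s\<close> are the \<open>s\<close>-th modes of the generators in the blocks
  $\mathfrak{gl}(m)$, $\mathfrak{gl}(n)$ and the lower left one; the indices
  \<open>i\<close>, \<open>j\<close> are rows of the pyramid.\<close>

definition am :: "nat \<Rightarrow> nat \<Rightarrow> int \<Rightarrow> 'v \<Rightarrow> 'v"
  where "am i j s v = x (E i j) \<langle>s\<rangle> v"

definition bm :: "nat \<Rightarrow> nat \<Rightarrow> int \<Rightarrow> 'v \<Rightarrow> 'v"
  where "bm i j s v = x (E (i + n) (j + n)) \<langle>s\<rangle> v"

definition cm :: "nat \<Rightarrow> nat \<Rightarrow> int \<Rightarrow> 'v \<Rightarrow> 'v"
  where "cm i j s v = x (E (i + n) j) \<langle>s\<rangle> v"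

lemmas mode_defs = am_def bm_def cm_def

lemma mode_linear:
  "am i j s (u + v) = am i j s u + am i j s v" "am i j s (u - v) = am i j s u - am i j s v"
  "am i j s (- u) = - am i j s u" "am i j s 0 = 0" "am i j s (c \<odot> u) = c \<odot> am i j s u"
  "am i j s (guard P u) = guard P (am i j s u)"
  "am i j s (\<Sum>a\<in>S. f a) = (\<Sum>a\<in>S. am i j s (f a))"
  "bm i j s (u + v) = bm i j s u + bm i j s v" "bm i j s (u - v) = bm i j s u - bm i j s v"
  "bm i j s (- u) = - bm i j s u" "bm i j s 0 = 0" "bm i j s (c \<odot> u) = c \<odot> bm i j s u"
  "bm i j s (guard P u) = guard P (bm i j s u)"
  "bm i j s (\<Sum>a\<in>S. f a) = (\<Sum>a\<in>S. bm i j s (f a))"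
  "cm i j s (u + v) = cm i j s u + cm i j s v" "cm i j s (u - v) = cm i j s u - cm i j s v"
  "cm i j s (- u) = - cm i j s u" "cm i j s 0 = 0" "cm i j s (c \<odot> u) = c \<odot> cm i j s u"
  "cm i j s (guard P u) = guard P (cm i j s u)"
  "cm i j s (\<Sum>a\<in>S. f a) = (\<Sum>a\<in>S. cm i j s (f a))"
  for f :: "nat \<Rightarrow> 'v"
  by (simp_all add: mode_defs nprod_add_right nprod_diff_right nprod_uminus_right nprod_smul_right
      nprod_sum_right guard_def)

lemma mode_vacuum [simp]:
  "s \<ge> 0 \<Longrightarrow> am i j s \<Omega> = 0" "s \<ge> 0 \<Longrightarrow> bm i j s \<Omega> = 0" "s \<ge> 0 \<Longrightarrow> cm i j s \<Omega> = 0"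
  by (simp_all add: mode_defs vacuum_right_nonneg)

lemma gen_in_basis:
  "i \<in> I \<Longrightarrow> j \<in> I \<Longrightarrow> E i j \<in> b_basis m n"
  "i \<in> I2 \<Longrightarrow> j \<in> I2 \<Longrightarrow> E (i + n) (j + n) \<in> b_basis m n"
  "i \<in> I2 \<Longrightarrow> j \<in> I \<Longrightarrow> E (i + n) j \<in> b_basis m n"
  by (auto simp: I_def I2_def b_basis_def col_def)

lemma gen_in_a_basis:
  "i \<in> I \<Longrightarrow> j \<in> I \<Longrightarrow> E i j \<in> a_basis m n"
  "i \<in> I2 \<Longrightarrow> j \<in> I2 \<Longrightarrow> E (i + n) (j + n) \<in> a_basis m n"
  "i \<in> I2 \<Longrightarrow> j \<in> I \<Longrightarrow> E (i + n) j \<in> a_basis m n"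
  using gen_in_basis by (auto simp: a_basis_def)

lemma mode_index_bounds:
  "i \<in> I \<Longrightarrow> i \<le> m" "i \<in> I2 \<Longrightarrow> m < i + n" "i \<in> I \<Longrightarrow> j \<in> I2 \<Longrightarrow> i \<noteq> j + n"
  "i \<in> I \<Longrightarrow> j \<in> I2 \<Longrightarrow> j + n \<noteq> i"
  by (auto simp: I_def I2_def)

lemma E_commutator:
  assumes "E p q \<in> a_basis m n" "E i j \<in> a_basis m n"
  shows "x (E p q) \<langle>r\<rangle> (x (E i j) \<langle>s\<rangle> v) = x (E i j) \<langle>s\<rangle> (x (E p q) \<langle>r\<rangle> v)
    + (if q = i then x (E p j) \<langle>r + s\<rangle> v else 0) - (if p = j then x (E i q) \<langle>r + s\<rangle> v else 0)
    + (if r + s = 0 then (of_int r * form m \<alpha>\<^sub>1 \<alpha>\<^sub>2 (E p q) (E i j)) \<odot> v else 0)"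
proof -
  have "lin_comb V x (bracket (E p q) (E i j)) =
      (if q = i then x (E p j) else 0) - (if p = j then x (E i q) else 0)"
    by (simp add: lin_comb_diff)
  then show ?thesis
    using gen_commutator[OF assms, of r s v]
    by (simp add: nprod_diff_left del: bracket.simps form.simps)
qed

lemma form_a_a:
  assumes "p \<in> I" "q \<in> I" "i \<in> I" "j \<in> I"
  shows "form m \<alpha>\<^sub>1 \<alpha>\<^sub>2 (E p q) (E i j) =
    (if p = j then if q = i then \<alpha>\<^sub>1 else 0 else 0) + (if p = q then if i = j then 1 else 0 else 0)"
  using assms by (simp add: mode_index_bounds(1))

lemma form_b_b:
  assumes "p \<in> I2" "q \<in> I2" "i \<in> I2" "j \<in> I2"
  shows "form m \<alpha>\<^sub>1 \<alpha>\<^sub>2 (E (p + n) (q + n)) (E (i + n) (j + n)) =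
    (if p = j then if q = i then \<alpha>\<^sub>2 else 0 else 0) + (if p = q then if i = j then 1 else 0 else 0)"
proof -
  have "m < p + n" "m < q + n" "m < i + n" "m < j + n"
    using assms by (auto simp: I2_def)
  then have "form m \<alpha>\<^sub>1 \<alpha>\<^sub>2 (E (p + n) (q + n)) (E (i + n) (j + n)) =
      \<alpha>\<^sub>2 * of_bool (p + n = j + n \<and> i + n = q + n) + of_bool (p + n = q + n \<and> i + n = j + n)"
    by (simp only: form.simps not_le[symmetric] simp_thms if_True if_False)
  then show ?thesis
    by (simp add: eq_commute[of q i])
qed

text \<open>The first index p + n exceeds m, which excludes the form of the first block; an index of
  \<open>E i j\<close> that is at most m excludes that of the second.\<close>

lemma form_left_lower:
  assumes "p \<in> I2" "i \<in> I \<or> j \<in> I"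
  shows "form m \<alpha>\<^sub>1 \<alpha>\<^sub>2 (E (p + n) q) (E i j) = 0"
proof -
  have "\<not> p + n \<le> m" "\<not> m < i \<or> \<not> m < j"
    using assms by (auto simp: I2_def I_def)
  then show ?thesis
    by (auto simp only: form.simps simp_thms if_False)
qed

lemma form_lower_lower:
  assumes "p \<in> I2" "q \<in> I"
  shows "form m \<alpha>\<^sub>1 \<alpha>\<^sub>2 (E (p + n) q) (E i j) = 0"
proof -
  have "\<not> p + n \<le> m" "\<not> m < q"
    using assms by (auto simp: I2_def I_def)
  then show ?thesis
    by (auto simp only: form.simps simp_thms if_False)
qed

lemmas form_blocks = form_a_a form_b_b form_left_lower form_lower_lower

section \<open>Commutation relations within and between the blocks\<close>

lemma am_am:
  assumes "p \<in> I" "q \<in> I" "i \<in> I" "j \<in> I"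
  shows "am p q r (am i j s v) = am i j s (am p q r v)
    + guard (q = i) (am p j (r + s) v) - guard (p = j) (am i q (r + s) v)
    + guard (r + s = 0) (guard (p = j) (guard (q = i) ((of_int r * \<alpha>\<^sub>1) \<odot> v))
        + guard (p = q) (guard (i = j) (of_int r \<odot> v)))"
  using assms unfolding mode_defs
  by (subst E_commutator)
    (simp_all add: form_blocks gen_in_a_basis distrib_left scale_left_distrib guard_def
      del: form.simps)

lemma bm_bm:
  assumes "p \<in> I2" "q \<in> I2" "i \<in> I2" "j \<in> I2"
  shows "bm p q r (bm i j s v) = bm i j s (bm p q r v)
    + guard (q = i) (bm p j (r + s) v) - guard (p = j) (bm i q (r + s) v)
    + guard (r + s = 0) (guard (p = j) (guard (q = i) ((of_int r * \<alpha>\<^sub>2) \<odot> v))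
        + guard (p = q) (guard (i = j) (of_int r \<odot> v)))"
  using assms E_commutator[of "p + n" "q + n" "i + n" "j + n" r s v] unfolding mode_defs
  by (simp add: form_blocks gen_in_a_basis mode_index_bounds distrib_left scale_left_distrib guard_def
      del: form.simps)

lemma bm_am:
  assumes "p \<in> I2" "q \<in> I2" "i \<in> I" "j \<in> I"
  shows "bm p q r (am i j s v) = am i j s (bm p q r v)"
  using assms E_commutator[of "p + n" "q + n" i j r s v] unfolding mode_defs
  by (simp add: form_blocks gen_in_a_basis mode_index_bounds distrib_left scale_left_distrib guard_def
      del: form.simps)

lemma cm_am:
  assumes "p \<in> I2" "q \<in> I" "i \<in> I" "j \<in> I"
  shows "cm p q r (am i j s v) = am i j s (cm p q r v) + guard (q = i) (cm p j (r + s) v)"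
  using assms E_commutator[of "p + n" q i j r s v] unfolding mode_defs
  by (simp add: form_blocks gen_in_a_basis mode_index_bounds distrib_left scale_left_distrib guard_def
      del: form.simps)

lemma bm_cm:
  assumes "p \<in> I2" "q \<in> I2" "i \<in> I2" "j \<in> I"
  shows "bm p q r (cm i j s v) = cm i j s (bm p q r v) + guard (q = i) (cm p j (r + s) v)"
  using assms E_commutator[of "p + n" "q + n" "i + n" j r s v] unfolding mode_defs
  by (simp add: form_blocks gen_in_a_basis mode_index_bounds distrib_left scale_left_distrib guard_def
      del: form.simps)

lemma cm_cm:
  assumes "p \<in> I2" "q \<in> I" "i \<in> I2" "j \<in> I"
  shows "cm p q r (cm i j s v) = cm i j s (cm p q r v)"
  using assms E_commutator[of "p + n" q "i + n" j r s v] unfolding mode_defs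
  by (simp add: form_blocks gen_in_a_basis mode_index_bounds distrib_left scale_left_distrib guard_def
      del: form.simps)

section \<open>The elements of the W-algebra in terms of modes\<close>

definition W1 :: "nat \<Rightarrow> nat \<Rightarrow> 'v"
  where "W1 i j = am i j (- 1) \<Omega> + guard (i \<in> I2) (guard (j \<in> I2) (bm i j (- 1) \<Omega>))"

definition W2 :: "nat \<Rightarrow> nat \<Rightarrow> 'v"
  where "W2 i j = cm i j (- 1) \<Omega> - \<alpha>\<^sub>2 \<odot> am i j (- 2) \<Omega>
    + (\<Sum>u\<in>I2. am u j (- 1) (bm i u (- 1) \<Omega>)) - (\<Sum>u\<in>I1. am u j (- 1) (am i u (- 1) \<Omega>))"

lemma W2_elem_eq: "W2_elem V m n \<alpha>\<^sub>2 x i j = W2 i j"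
proof -
  have "x (E i j) \<langle>- 2\<rangle> \<Omega> = am i j (- 2) \<Omega>" for i j
    by (simp add: am_def)
  then show ?thesis
    by (simp add: W2_elem_def W2_def I1_def I2_def mode_defs vacuum_right)
qed

text \<open>Boxes in equal columns with rows i and j form one pair in the first column, and a second
  pair only if both rows have two boxes.\<close>

lemma W1_elem_eq:
  assumes "i \<in> I" "j \<in> I"
  shows "W1_elem V m n x i j = W1 i j"
proof -
  let ?S = "{(h, l). h \<in> {1..m + n} \<and> l \<in> {1..m + n} \<and>
        row m n h = i \<and> row m n l = j \<and> col m h = col m l}"
  have "?S = (if i \<in> I2 \<and> j \<in> I2 then {(i, j), (i + n, j + n)} else {(i, j)})"
    using assms n_le_m by (auto simp: I_def I2_def row_def col_def split: if_splits)
  then show ?thesis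
    using assms mode_index_bounds(3)[of i j]
    by (auto simp: W1_elem_def W1_def I2_def mode_defs vacuum_right I_def guard_def)
qed

text \<open>Oriented commutation relations: nonnegative modes move to the right, and the
  remaining ones are sorted as $a$, $b$, $c$ with increasing modes.\<close>

lemma am_order:
  assumes "r > s" "p \<in> I" "q \<in> I" "i \<in> I" "j \<in> I"
  shows "am p q r (am i j s v) = am i j s (am p q r v)
    + guard (q = i) (am p j (r + s) v) - guard (p = j) (am i q (r + s) v)
    + guard (r + s = 0) (guard (p = j) (guard (q = i) ((of_int r * \<alpha>\<^sub>1) \<odot> v))
        + guard (p = q) (guard (i = j) (of_int r \<odot> v)))"
  using assms by (intro am_am)

lemma bm_order:
  assumes "r > s" "p \<in> I2" "q \<in> I2" "i \<in> I2" "j \<in> I2"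
  shows "bm p q r (bm i j s v) = bm i j s (bm p q r v)
    + guard (q = i) (bm p j (r + s) v) - guard (p = j) (bm i q (r + s) v)
    + guard (r + s = 0) (guard (p = j) (guard (q = i) ((of_int r * \<alpha>\<^sub>2) \<odot> v))
        + guard (p = q) (guard (i = j) (of_int r \<odot> v)))"
  using assms by (intro bm_bm)

lemma cm_order:
  assumes "r > s" "p \<in> I2" "q \<in> I" "i \<in> I2" "j \<in> I"
  shows "cm p q r (cm i j s v) = cm i j s (cm p q r v)"
  using assms by (intro cm_cm)

text \<open>The rules for two different blocks come in pairs with complementary side conditions on
  the modes: exactly one orientation applies to each pair of factors, so the rewriting cannot undo
  its own steps.\<close>

lemma bm_am_order:
  assumes "r \<ge> 0 \<or> s < 0" "p \<in> I2" "q \<in> I2" "i \<in> I" "j \<in> I"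
  shows "bm p q r (am i j s v) = am i j s (bm p q r v)"
  using assms by (intro bm_am)

lemma am_bm_order:
  assumes "s \<ge> 0" "r < 0" "p \<in> I2" "q \<in> I2" "i \<in> I" "j \<in> I"
  shows "am i j s (bm p q r v) = bm p q r (am i j s v)"
  using assms by (simp add: bm_am)

lemma cm_am_order:
  assumes "s < 0" "p \<in> I2" "q \<in> I" "i \<in> I" "j \<in> I"
  shows "cm p q r (am i j s v) = am i j s (cm p q r v) + guard (q = i) (cm p j (r + s) v)"
  using assms by (intro cm_am)

lemma am_cm_order:
  assumes "s \<ge> 0" "p \<in> I2" "q \<in> I" "i \<in> I" "j \<in> I"
  shows "am i j s (cm p q r v) = cm p q r (am i j s v) - guard (q = i) (cm p j (r + s) v)"
  using cm_am[OF assms(2-), of r s v] by simp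

lemma bm_cm_order:
  assumes "r \<ge> 0" "p \<in> I2" "q \<in> I2" "i \<in> I2" "j \<in> I"
  shows "bm p q r (cm i j s v) = cm i j s (bm p q r v) + guard (q = i) (cm p j (r + s) v)"
  using assms by (intro bm_cm)

lemma cm_bm_order:
  assumes "r < 0" "p \<in> I2" "q \<in> I2" "i \<in> I2" "j \<in> I"
  shows "cm i j s (bm p q r v) = bm p q r (cm i j s v) - guard (q = i) (cm p j (r + s) v)"
  using bm_cm[OF assms(2-), of r s v] by simp

lemmas mode_order = am_order bm_order cm_order bm_am_order am_bm_order cm_am_order am_cm_order
  bm_cm_order cm_bm_order

lemmas vector_linear = mode_linear guard_linear scale_right_distrib scale_right_diff_distrib
  scale_sum_right[symmetric] sum.distrib sum_subtractf sum_negf sum_guard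

lemma functional_guard: "functional \<phi> \<Longrightarrow> \<phi> (guard P v) = of_bool P * \<phi> v"
  by (simp add: guard_def functional_zero)

lemmas functional_linear = functional_add functional_diff functional_uminus functional_smul
  functional_sum functional_zero functional_guard

section \<open>Modes of the generators on $W^{(2)}$\<close>

text \<open>In the lower index \<open>j\<close>, zero modes act as on a row vector: the p = j
  contributions of all four parts of \<open>W2\<close> reassemble to - \<open>W2 i q\<close>. The
  remaining terms come from the upper index and from the sums running over only part of the
  rows.\<close>

lemma am_W2_0:
  assumes "p \<in> I" "q \<in> I" "i \<in> I2" "j \<in> I"
  shows "am p q 0 (W2 i j) = guard (q \<in> I2) (am p j (- 1) (bm i q (- 1) \<Omega>))
    + guard (p \<in> I1) (am p j (- 1) (am i q (- 1) \<Omega>))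
    - guard (q \<in> I1) (am p j (- 1) (am i q (- 1) \<Omega>))
    - guard (p = j) (W2 i q)
    - guard (q = i) (\<alpha>\<^sub>2 \<odot> am p j (- 2) \<Omega> + (\<Sum>u\<in>I1. am u j (- 1) (am p u (- 1) \<Omega>)))"
    (is "?lhs = ?rhs")
proof (rule eq_by_functionals)
  fix \<phi> assume \<phi>: "functional \<phi>"
  have "p \<in> I" "q \<in> I" "j \<in> I"
    using assms by simp_all
  \<comment> \<open>Contracting a sum over \<open>I1\<close> or \<open>I2\<close> leaves a condition
    that the row hit by the delta lies in that set; splitting on the part containing each row
    decides these conditions.\<close>
  from this[THEN index_cases] show "\<phi> ?lhs = \<phi> ?rhs"
    using assms
    by (elim disjE conjE)
      (simp_all add: W2_def mode_order vector_linear functional_linear[OF \<phi>]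
        card_I1 cong: sum.cong flip: sum_distrib_left, (auto simp: algebra_simps)?)
qed

text \<open>For p = j the first coefficient \<open>\<alpha>\<^sub>1\<close> of \<open>am i q\<close>
  is \<open>\<alpha>\<^sub>2\<close> - (m - n): \<open>\<alpha>\<^sub>2\<close> stems from the
  derivative term of \<open>W2\<close>, and each row in \<open>I1\<close> subtracts 1 by a double
  contraction.\<close>

lemma am_W2_1:
  assumes "p \<in> I" "q \<in> I" "i \<in> I2" "j \<in> I"
  shows "am p q 1 (W2 i j) = guard (p = j) (\<alpha>\<^sub>1 \<odot> am i q (- 1) \<Omega>)
    + guard (p = j) (guard (q \<in> I2) (\<alpha>\<^sub>1 \<odot> bm i q (- 1) \<Omega>))
    - guard (p = j) (guard (q \<in> I1) (\<alpha>\<^sub>1 \<odot> am i q (- 1) \<Omega>))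
    + guard (p = q) (guard (j \<in> I2) (bm i j (- 1) \<Omega>))
    - guard (p = q) (guard (j \<in> I1) (am i j (- 1) \<Omega>))
    + guard (p = q) (guard (q \<in> I1) (am i j (- 1) \<Omega>))
    - guard (q = i) (\<alpha>\<^sub>2 \<odot> am p j (- 1) \<Omega>)
    - guard (q = i) (guard (p \<in> I1) (\<alpha>\<^sub>1 \<odot> am p j (- 1) \<Omega>))
    + guard (q = i) (guard (p = j) (\<Sum>u\<in>I1. am u u (- 1) \<Omega>))
    - guard (i = j) (guard (q \<in> I1) (am p q (- 1) \<Omega>))"
    (is "?lhs = ?rhs")
proof (rule eq_by_functionals)
  fix \<phi> assume \<phi>: "functional \<phi>"
  have "p \<in> I" "q \<in> I" "j \<in> I"
    using assms by simp_all
  from this[THEN index_cases] show "\<phi> ?lhs = \<phi> ?rhs"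
    using assms
    by (elim disjE conjE)
      (simp_all add: W2_def mode_order vector_linear functional_linear[OF \<phi>]
        card_I1 cong: sum.cong flip: sum_distrib_left, (auto simp: algebra_simps)?)
qed

text \<open>Mode 2 against the derivative term gives the contributions with factor 2. The part
  \<open>\<alpha>\<^sub>1 * (\<alpha>\<^sub>2 - \<alpha>\<^sub>1)\<close> is
  \<open>\<alpha>\<^sub>1\<close> for each row in \<open>I1\<close>.\<close>

lemma am_W2_2:
  assumes "p \<in> I" "q \<in> I" "i \<in> I2" "j \<in> I"
  shows "am p q 2 (W2 i j) =
    guard (p = j) (guard (q = i) ((\<alpha>\<^sub>1 * (\<alpha>\<^sub>2 - \<alpha>\<^sub>1) - 2 * \<alpha>\<^sub>1 * \<alpha>\<^sub>2) \<odot> \<Omega>))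
    - guard (p = q) (guard (i = j) ((2 * \<alpha>\<^sub>2) \<odot> \<Omega>))
    - guard (p = q) (guard (i = j) (guard (q \<in> I1) (\<alpha>\<^sub>1 \<odot> \<Omega>)))"
    (is "?lhs = ?rhs")
proof (rule eq_by_functionals)
  fix \<phi> assume \<phi>: "functional \<phi>"
  have "p \<in> I" "q \<in> I" "j \<in> I"
    using assms by simp_all
  from this[THEN index_cases] show "\<phi> ?lhs = \<phi> ?rhs"
    using assms
    by (elim disjE conjE)
      (simp_all add: W2_def mode_order vector_linear functional_linear[OF \<phi>]
        card_I1 cong: sum.cong flip: sum_distrib_left, (auto simp: algebra_simps)?)
qed

text \<open>The result would have negative conformal weight.\<close>

lemma am_W2_ge:
  assumes "p \<in> I" "q \<in> I" "i \<in> I2" "j \<in> I" "k \<ge> 3"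
  shows "am p q k (W2 i j) = 0"
    (is "?lhs = ?rhs")
proof (rule eq_by_functionals)
  fix \<phi> assume \<phi>: "functional \<phi>"
  have "p \<in> I" "q \<in> I" "j \<in> I"
    using assms by simp_all
  from this[THEN index_cases] show "\<phi> ?lhs = \<phi> ?rhs"
    using assms
    by (elim disjE conjE)
      (simp_all add: W2_def mode_order vector_linear functional_linear[OF \<phi>]
        card_I1 cong: sum.cong flip: sum_distrib_left, (auto simp: algebra_simps)?)
qed

lemma bm_W2_0:
  assumes "p \<in> I2" "q \<in> I2" "i \<in> I2" "j \<in> I"
  shows "bm p q 0 (W2 i j) =
    guard (q = i) (cm p j (- 1) \<Omega> + (\<Sum>u\<in>I2. am u j (- 1) (bm p u (- 1) \<Omega>)))
    - am p j (- 1) (bm i q (- 1) \<Omega>)"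
    (is "?lhs = ?rhs")
proof (rule eq_by_functionals)
  fix \<phi> assume \<phi>: "functional \<phi>"
  have "p \<in> I" "q \<in> I" "j \<in> I"
    using assms by simp_all
  from this[THEN index_cases] show "\<phi> ?lhs = \<phi> ?rhs"
    using assms
    by (elim disjE conjE)
      (simp_all add: W2_def mode_order vector_linear functional_linear[OF \<phi>]
        card_I1 cong: sum.cong flip: sum_distrib_left, (auto simp: algebra_simps)?)
qed

lemma bm_W2_1:
  assumes "p \<in> I2" "q \<in> I2" "i \<in> I2" "j \<in> I"
  shows "bm p q 1 (W2 i j) = guard (q = i) (\<alpha>\<^sub>2 \<odot> am p j (- 1) \<Omega>)
    + guard (p = q) (am i j (- 1) \<Omega>)"
    (is "?lhs = ?rhs")
proof (rule eq_by_functionals)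
  fix \<phi> assume \<phi>: "functional \<phi>"
  have "p \<in> I" "q \<in> I" "j \<in> I"
    using assms by simp_all
  from this[THEN index_cases] show "\<phi> ?lhs = \<phi> ?rhs"
    using assms
    by (elim disjE conjE)
      (simp_all add: W2_def mode_order vector_linear functional_linear[OF \<phi>]
        card_I1 cong: sum.cong flip: sum_distrib_left, (auto simp: algebra_simps)?)
qed

text \<open>Mode 2 could still reach the vacuum by weight, but \<open>W2\<close> contains no
  derivative of a second-block generator, and its quadratic part pairs such a generator only with
  one of the first block, which commutes with it.\<close>

lemma bm_W2_ge:
  assumes "p \<in> I2" "q \<in> I2" "i \<in> I2" "j \<in> I" "k \<ge> 2"
  shows "bm p q k (W2 i j) = 0"
    (is "?lhs = ?rhs")
proof (rule eq_by_functionals)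
  fix \<phi> assume \<phi>: "functional \<phi>"
  have "p \<in> I" "q \<in> I" "j \<in> I"
    using assms by simp_all
  from this[THEN index_cases] show "\<phi> ?lhs = \<phi> ?rhs"
    using assms
    by (elim disjE conjE)
      (simp_all add: W2_def mode_order vector_linear functional_linear[OF \<phi>]
        card_I1 cong: sum.cong flip: sum_distrib_left, (auto simp: algebra_simps)?)
qed

lemma cm_W2_0:
  assumes "p \<in> I2" "q \<in> I" "i \<in> I2" "j \<in> I"
  shows "cm p q 0 (W2 i j) = guard (q \<in> I2) (cm p j (- 1) (bm i q (- 1) \<Omega>))
    - guard (q \<in> I1) (cm p j (- 1) (am i q (- 1) \<Omega>)) - am p j (- 1) (cm i q (- 1) \<Omega>)
    - guard (q = i) (\<alpha>\<^sub>2 \<odot> cm p j (- 2) \<Omega>)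
    - guard (q = i) (\<Sum>u\<in>I1. am u j (- 1) (cm p u (- 1) \<Omega>))"
    (is "?lhs = ?rhs")
proof (rule eq_by_functionals)
  fix \<phi> assume \<phi>: "functional \<phi>"
  have "p \<in> I" "q \<in> I" "j \<in> I"
    using assms by simp_all
  from this[THEN index_cases] show "\<phi> ?lhs = \<phi> ?rhs"
    using assms
    by (elim disjE conjE)
      (simp_all add: W2_def mode_order vector_linear functional_linear[OF \<phi>]
        card_I1 cong: sum.cong flip: sum_distrib_left, (auto simp: algebra_simps)?)
qed

lemma cm_W2_1:
  assumes "p \<in> I2" "q \<in> I" "i \<in> I2" "j \<in> I"
  shows "cm p q 1 (W2 i j) = - guard (q = i) (\<alpha>\<^sub>2 \<odot> cm p j (- 1) \<Omega>)
    - guard (p = q) (cm i j (- 1) \<Omega>) - guard (i = j) (guard (q \<in> I1) (cm p q (- 1) \<Omega>))"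
    (is "?lhs = ?rhs")
proof (rule eq_by_functionals)
  fix \<phi> assume \<phi>: "functional \<phi>"
  have "p \<in> I" "q \<in> I" "j \<in> I"
    using assms by simp_all
  from this[THEN index_cases] show "\<phi> ?lhs = \<phi> ?rhs"
    using assms
    by (elim disjE conjE)
      (simp_all add: W2_def mode_order vector_linear functional_linear[OF \<phi>]
        card_I1 cong: sum.cong flip: sum_distrib_left, (auto simp: algebra_simps)?)
qed

lemma cm_W2_ge:
  assumes "p \<in> I2" "q \<in> I" "i \<in> I2" "j \<in> I" "k \<ge> 2"
  shows "cm p q k (W2 i j) = 0"
    (is "?lhs = ?rhs")
proof (rule eq_by_functionals)
  fix \<phi> assume \<phi>: "functional \<phi>"
  have "p \<in> I" "q \<in> I" "j \<in> I"
    using assms by simp_all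
  from this[THEN index_cases] show "\<phi> ?lhs = \<phi> ?rhs"
    using assms
    by (elim disjE conjE)
      (simp_all add: W2_def mode_order vector_linear functional_linear[OF \<phi>]
        card_I1 cong: sum.cong flip: sum_distrib_left, (auto simp: algebra_simps)?)
qed

section \<open>Products of $W^{(1)}$ and $W^{(2)}$\<close>

lemma gen_even:
  assumes "E i j \<in> a_basis m n"
  shows "x (E i j) \<in> parity V False"
  using gen_parity[OF assms] by simp

lemma transl_mode:
  "i \<in> I \<Longrightarrow> j \<in> I \<Longrightarrow> \<partial> (am i j s v) = of_int (- s) \<odot> am i j (s - 1) v + am i j s (\<partial> v)"
  "i \<in> I2 \<Longrightarrow> j \<in> I2 \<Longrightarrow> \<partial> (bm i j s v) = of_int (- s) \<odot> bm i j (s - 1) v + bm i j s (\<partial> v)"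
  "i \<in> I2 \<Longrightarrow> j \<in> I \<Longrightarrow> \<partial> (cm i j s v) = of_int (- s) \<odot> cm i j (s - 1) v + cm i j s (\<partial> v)"
  by (simp_all only: mode_defs transl_nprod transl_nprod_left gen_even gen_in_a_basis)

lemma mode_nprod:
  assumes "u \<in> I" "w \<in> I"
  shows "(am u w (- 1) \<Omega>) \<langle>s\<rangle> y = am u w s y"
    "(am u w (- 2) \<Omega>) \<langle>s\<rangle> y = of_int (- s) \<odot> am u w (s - 1) y"
  using transl_nprod_left[OF gen_even[OF gen_in_a_basis(1)[OF assms]]]
  by (simp_all add: am_def vacuum_right transl_def)

lemma W1_nprod:
  assumes "i \<in> I" "j \<in> I"
  shows "W1 i j \<langle>s\<rangle> y = am i j s y + guard (i \<in> I2) (guard (j \<in> I2) (bm i j s y))"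
  using assms by (simp add: W1_def nprod_add_left guard_def mode_defs vacuum_right)

lemma transl_W1_nprod:
  assumes "i \<in> I" "j \<in> I"
  shows "(\<partial> (W1 i j)) \<langle>s\<rangle> y = of_int (- s) \<odot> (W1 i j \<langle>s - 1\<rangle> y)"
proof (rule transl_nprod_left)
  show "W1 i j \<in> parity V False"
    using assms gen_even[OF gen_in_a_basis(1)[of i j]] gen_even[OF gen_in_a_basis(2)[of i j]]
      parity_subspace
    by (auto simp: W1_def guard_def mode_defs vacuum_right intro: subspace_add)
qed

lemma transl_W1:
  assumes "i \<in> I" "j \<in> I"
  shows "\<partial> (W1 i j) = am i j (- 2) \<Omega> + guard (i \<in> I2) (guard (j \<in> I2) (bm i j (- 2) \<Omega>))"
  using assms by (simp add: W1_def transl_add transl_mode mode_linear guard_def)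

lemma transl_transl_W1:
  assumes "i \<in> I" "j \<in> I"
  shows "\<partial> (\<partial> (W1 i j)) = 2 \<odot> am i j (- 3) \<Omega> + guard (i \<in> I2) (guard (j \<in> I2) (2 \<odot> bm i j (- 3) \<Omega>))"
  using assms by (simp add: transl_W1 transl_add transl_mode mode_linear guard_def)

lemma am_bm_nprod:
  assumes "u \<in> I" "q \<in> I" "p \<in> I2" "w \<in> I2"
    and "\<And>t. t \<ge> K \<Longrightarrow> bm p w (s + int t) y = 0" "\<And>t. t \<ge> K \<Longrightarrow> am u q (int t) y = 0"
  shows "am u q (- 1) (bm p w (- 1) \<Omega>) \<langle>s\<rangle> y =
    (\<Sum>t<K. am u q (- 1 - int t) (bm p w (s + int t) y) + bm p w (s - 1 - int t) (am u q (int t) y))"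
  using assms unfolding mode_defs vacuum_right
  by (intro nprod_normal_ordered gen_even gen_in_a_basis) auto

lemma am_am_nprod:
  assumes "u \<in> I" "q \<in> I" "p \<in> I" "w \<in> I"
    and "\<And>t. t \<ge> K \<Longrightarrow> am p w (s + int t) y = 0" "\<And>t. t \<ge> K \<Longrightarrow> am u q (int t) y = 0"
  shows "am u q (- 1) (am p w (- 1) \<Omega>) \<langle>s\<rangle> y =
    (\<Sum>t<K. am u q (- 1 - int t) (am p w (s + int t) y) + am p w (s - 1 - int t) (am u q (int t) y))"
  using assms unfolding mode_defs vacuum_right
  by (intro nprod_normal_ordered gen_even gen_in_a_basis) auto

text \<open>The two conditions on \<open>K\<close> cut off the two families of modes in a normally
  ordered product. The derivative term enters with a plus sign because the s-th mode of a derivative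
  is -s times the mode s - 1.\<close>

lemma W2_nprod:
  assumes "p \<in> I2" "q \<in> I"
    and a: "\<And>u w k. u \<in> I \<Longrightarrow> w \<in> I \<Longrightarrow> k \<ge> r \<Longrightarrow> am u w k y = 0"
    and b: "\<And>u w k. u \<in> I2 \<Longrightarrow> w \<in> I2 \<Longrightarrow> k \<ge> r \<Longrightarrow> bm u w k y = 0"
    and K: "int K \<ge> r" "s + int K \<ge> r"
  shows "W2 p q \<langle>s\<rangle> y = cm p q s y + (of_int s * \<alpha>\<^sub>2) \<odot> am p q (s - 1) y
    + (\<Sum>u\<in>I2. \<Sum>t<K. am u q (- 1 - int t) (bm p u (s + int t) y)
        + bm p u (s - 1 - int t) (am u q (int t) y))
    - (\<Sum>u\<in>I1. \<Sum>t<K. am u q (- 1 - int t) (am p u (s + int t) y)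
        + am p u (s - 1 - int t) (am u q (int t) y))"
proof -
  have "(am u q (- 1) (bm p u (- 1) \<Omega>)) \<langle>s\<rangle> y =
      (\<Sum>t<K. am u q (- 1 - int t) (bm p u (s + int t) y)
      + bm p u (s - 1 - int t) (am u q (int t) y))" if "u \<in> I2" for u
    using that assms(1,2) K by (intro am_bm_nprod) (auto intro!: a b)
  moreover have "(am u q (- 1) (am p u (- 1) \<Omega>)) \<langle>s\<rangle> y =
      (\<Sum>t<K. am u q (- 1 - int t) (am p u (s + int t) y)
      + am p u (s - 1 - int t) (am u q (int t) y))" if "u \<in> I1" for u
    using that assms(1,2) K by (intro am_am_nprod) (auto intro!: a)
  moreover have "(cm p q (- 1) \<Omega>) \<langle>s\<rangle> y = cm p q s y"
    by (simp add: cm_def vacuum_right)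
  ultimately show ?thesis
    using assms(1,2)
    by (simp add: W2_def nprod_add_left nprod_diff_left nprod_smul_left nprod_sum_left mode_nprod
        mult.commute cong: sum.cong del: sum.lessThan_Suc)
qed

lemma W2_nprod_W2:
  assumes "p \<in> I2" "q \<in> I" "i \<in> I2" "j \<in> I" "s \<ge> 0"
  shows "W2 p q \<langle>s\<rangle> W2 i j = cm p q s (W2 i j) + (of_int s * \<alpha>\<^sub>2) \<odot> am p q (s - 1) (W2 i j)
    + (\<Sum>u\<in>I2. \<Sum>t<3. am u q (- 1 - int t) (bm p u (s + int t) (W2 i j))
        + bm p u (s - 1 - int t) (am u q (int t) (W2 i j)))
    - (\<Sum>u\<in>I1. \<Sum>t<3. am u q (- 1 - int t) (am p u (s + int t) (W2 i j))
        + am p u (s - 1 - int t) (am u q (int t) (W2 i j)))"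
  using assms by (intro W2_nprod[where r = 3]) (auto simp: am_W2_ge bm_W2_ge)

lemma W2_nprod_W1:
  assumes "p \<in> I2" "q \<in> I" "i \<in> I" "j \<in> I"
  shows "W2 p q \<langle>- 1\<rangle> W1 i j = cm p q (- 1) (W1 i j) - \<alpha>\<^sub>2 \<odot> am p q (- 2) (W1 i j)
    + (\<Sum>u\<in>I2. am u q (- 1) (bm p u (- 1) (W1 i j)) + bm p u (- 2) (am u q 0 (W1 i j))
        + am u q (- 2) (bm p u 0 (W1 i j)) + bm p u (- 3) (am u q 1 (W1 i j))
        + am u q (- 3) (bm p u 1 (W1 i j)))
    - (\<Sum>u\<in>I1. am u q (- 1) (am p u (- 1) (W1 i j)) + am p u (- 2) (am u q 0 (W1 i j))
        + am u q (- 2) (am p u 0 (W1 i j)) + am p u (- 3) (am u q 1 (W1 i j))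
        + am u q (- 3) (am p u 1 (W1 i j)))"
proof -
  have a: "am u w k (W1 i j) = 0" if "u \<in> I" "w \<in> I" "k \<ge> 2" for u w k
    using that assms by (simp add: W1_def vector_linear mode_order guard_def)
  have b: "bm u w k (W1 i j) = 0" if "u \<in> I2" "w \<in> I2" "k \<ge> 2" for u w k
    using that assms by (simp add: W1_def vector_linear mode_order guard_def)
  show ?thesis
    \<comment> \<open>\<open>W1\<close> has weight 1, so modes from 2 on kill it; K = 3 is needed
      since the inner mode starts at -1.\<close>
    using W2_nprod[OF assms(1,2), where r = 2 and K = 3 and s = "- 1" and y = "W1 i j"] a b
      assms by (simp add: numeral_3_eq_3 lessThan_Suc add_ac mode_linear cong: sum.cong)
qed

lemma I2_not_I1: "u \<in> I2 \<Longrightarrow> u \<notin> I1"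
  by (auto simp: I1_def I2_def)

lemma W2_nprod_nonneg:
  assumes "p \<in> I2" "q \<in> I" "i \<in> I2" "j \<in> I" "s \<ge> 0"
  shows "W2 p q \<langle>s\<rangle> W2 i j = cm p q s (W2 i j) + (of_int s * \<alpha>\<^sub>2) \<odot> am p q (s - 1) (W2 i j)
    + (\<Sum>u\<in>I2. am u q (- 1) (bm p u s (W2 i j)) + bm p u (s - 1) (am u q 0 (W2 i j))
        + am u q (- 2) (bm p u (s + 1) (W2 i j)) + bm p u (s - 2) (am u q 1 (W2 i j))
        + am u q (- 3) (bm p u (s + 2) (W2 i j)) + bm p u (s - 3) (am u q 2 (W2 i j)))
    - (\<Sum>u\<in>I1. am u q (- 1) (am p u s (W2 i j)) + am p u (s - 1) (am u q 0 (W2 i j))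
        + am u q (- 2) (am p u (s + 1) (W2 i j)) + am p u (s - 2) (am u q 1 (W2 i j))
        + am u q (- 3) (am p u (s + 2) (W2 i j)) + am p u (s - 3) (am u q 2 (W2 i j)))"
  using W2_nprod_W2[OF assms] by (simp add: numeral_3_eq_3 lessThan_Suc add_ac)

section \<open>The four products of \<open>W2\<close> with itself\<close>

lemmas W2_modes = am_W2_0 am_W2_1 am_W2_2 am_W2_ge bm_W2_0 bm_W2_1 bm_W2_ge cm_W2_0 cm_W2_1 cm_W2_ge

text \<open>Simplification is done in two stages. This set leaves \<open>W2\<close> folded, so that
  the formulas for modes acting on it still match; \<open>expansion_simps\<close> unfolds what
  remains into words in negative modes.\<close>

lemmas product_simps = W2_nprod_nonneg W2_nprod_W1 W1_nprod transl_W1_nprod W2_modes mode_order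
  I2_not_I1

lemmas expansion_simps = W1_def W2_def transl_W1 transl_transl_W1 transl_add transl_diff transl_sum
  transl_smul transl_mode mode_order card_I1 level_diff I2_not_I1

text \<open>The weight is 0, so only multiples of the vacuum occur. With m - n =
  \<open>\<alpha>\<^sub>2 - \<alpha>\<^sub>1\<close> the second coefficient factors as
  \<open>(\<alpha>\<^sub>1 + \<alpha>\<^sub>2) * (1 - \<alpha>\<^sub>1 * (2 * \<alpha>\<^sub>1 +
  \<alpha>\<^sub>2))\<close>.\<close>

lemma W2_nprod_W2_3:
  assumes "p \<in> I2" "q \<in> I" "i \<in> I2" "j \<in> I"
  shows "W2 p q \<langle>3\<rangle> W2 i j =
          ((1 + \<alpha>\<^sub>1\<^sup>2 - 6 * \<alpha>\<^sub>2\<^sup>2) * \<delta> (p = q) * \<delta> (i = j)) \<odot> \<Omega>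
    + ((6 * \<alpha>\<^sub>1 * \<alpha>\<^sub>2 * of_nat (m - n) + \<alpha>\<^sub>1 + \<alpha>\<^sub>2 + \<alpha>\<^sub>1\<^sup>2 * of_nat (m - n)
             - \<alpha>\<^sub>1 * (of_nat (m - n))\<^sup>2 - 6 * \<alpha>\<^sub>2\<^sup>2 * \<alpha>\<^sub>1) * \<delta> (p = j) * \<delta> (i = q)) \<odot> \<Omega>"
    (is "?lhs = ?rhs")
proof (rule eq_by_functionals)
  fix \<phi>
  assume "functional \<phi>"
  note linear = vector_linear functional_linear[OF this]
  \<comment> \<open>Equal modes are ordered by rows; unrestricted commutation relations would loop.\<close>
  note sort_rows = am_am[of p _ _ _ "- 1" "- 1"] am_am[of _ _ i _ "- 1" "- 1"]
    bm_bm[of p _ _ _ "- 1" "- 1"] bm_bm[of _ _ i _ "- 1" "- 1"]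
  from assms(2,4)[THEN index_cases] assms show "\<phi> ?lhs = \<phi> ?rhs"
    by (elim disjE conjE)
      (simp_all add: product_simps linear split del: if_split split_of_bool cong: sum.cong,
        simp_all add: expansion_simps sort_rows linear split del: if_split split_of_bool cong: sum.cong
          flip: sum_distrib_left, auto simp: algebra_simps power2_eq_square)
qed

text \<open>The right-hand side changes sign when (p, q) and (i, j) are exchanged. This is skew
  symmetry, whose derivative correction vanishes since the third product is a multiple of the
  vacuum.\<close>

lemma W2_nprod_W2_2:
  assumes "p \<in> I2" "q \<in> I" "i \<in> I2" "j \<in> I"
  shows "W2 p q \<langle>2\<rangle> W2 i j =
          (\<delta> (p = j) * \<delta> (q \<in> I2) * (\<alpha>\<^sub>1 * (\<alpha>\<^sub>1 + \<alpha>\<^sub>2) - 1)) \<odot> W1 i q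
    + (\<delta> (i = j) * \<delta> (q \<in> I2) * (\<alpha>\<^sub>1 - 2 * \<alpha>\<^sub>2)) \<odot> W1 p q
    - (\<delta> (i = q) * \<delta> (j \<in> I2) * (\<alpha>\<^sub>1 * (\<alpha>\<^sub>1 + \<alpha>\<^sub>2) - 1)) \<odot> W1 p j
    - (\<delta> (p = q) * \<delta> (j \<in> I2) * (\<alpha>\<^sub>1 - 2 * \<alpha>\<^sub>2)) \<odot> W1 i j"
    (is "?lhs = ?rhs")
proof (rule eq_by_functionals)
  fix \<phi>
  assume "functional \<phi>"
  note linear = vector_linear functional_linear[OF this]
  note sort_rows = am_am[of p _ _ _ "- 1" "- 1"] am_am[of _ _ i _ "- 1" "- 1"]
    bm_bm[of p _ _ _ "- 1" "- 1"] bm_bm[of _ _ i _ "- 1" "- 1"]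
  from assms(2,4)[THEN index_cases] assms show "\<phi> ?lhs = \<phi> ?rhs"
    by (elim disjE conjE)
      (simp_all add: product_simps linear split del: if_split split_of_bool cong: sum.cong,
        simp_all add: expansion_simps sort_rows linear split del: if_split split_of_bool cong: sum.cong
          flip: sum_distrib_left, auto simp: algebra_simps)
qed

text \<open>The factors 1 + \<delta> can be read off the lower left block. For i = j, one copy of
  \<open>cm p q\<close> comes from the sum over \<open>I2\<close>, where a zero mode of each of the
  two upper factors acts; a second copy, only for q in \<open>I1\<close>, comes from
  \<open>cm_W2_1\<close>.\<close>

lemma W2_nprod_W2_1:
  assumes "p \<in> I2" "q \<in> I" "i \<in> I2" "j \<in> I"
  shows "W2 p q \<langle>1\<rangle> W2 i j =
          (\<delta> (q \<in> I2 \<and> j \<in> I2) * \<alpha>\<^sub>1) \<odot> (W1 p j \<langle>- 1\<rangle> W1 i q)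
    + \<delta> (q \<in> I2 \<and> j \<in> I2) \<odot> (W1 p q \<langle>- 1\<rangle> W1 i j)
    - (\<delta> (q = i) * \<alpha>\<^sub>2) \<odot> W2 p j
    + (\<delta> (q = i) * \<delta> (j \<in> I2)) \<odot> (\<Sum>w\<in>I1. W1 p j \<langle>- 1\<rangle> W1 w w)
    - (\<delta> (q = i) * \<delta> (j \<in> I2) * \<alpha>\<^sub>1 * (\<alpha>\<^sub>1 + \<alpha>\<^sub>2)) \<odot> \<partial> (W1 p j)
    - (\<delta> (p = j) * \<alpha>\<^sub>2) \<odot> W2 i q
    + (\<delta> (p = j) * \<delta> (q \<in> I2)) \<odot> (\<Sum>a\<in>I1. W1 a a \<langle>- 1\<rangle> W1 i q)
    - (\<delta> (i = j) * (1 + \<delta> (q \<in> I1))) \<odot> W2 p q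
    - (2 * \<delta> (i = j) * \<delta> (q \<in> I2) * \<alpha>\<^sub>2) \<odot> \<partial> (W1 p q)
    - (\<delta> (p = q) * (1 + \<delta> (j \<in> I1))) \<odot> W2 i j
    - (\<delta> (p = j) * \<delta> (i = q)) \<odot>
            (\<Sum>a\<in>I1. \<Sum>w\<in>I1. W1 w a \<langle>- 1\<rangle> W1 a w)
    - (\<delta> (q = i) * \<delta> (p = j) * (\<alpha>\<^sub>1 + 2 * \<alpha>\<^sub>2)) \<odot> (\<Sum>a\<in>I1. \<partial> (W1 a a))"
    (is "?lhs = ?rhs")
proof (rule eq_by_functionals)
  fix \<phi>
  assume "functional \<phi>"
  note linear = vector_linear functional_linear[OF this]
  note sort_rows = am_am[of p _ _ _ "- 1" "- 1"] am_am[of _ _ i _ "- 1" "- 1"]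
    bm_bm[of p _ _ _ "- 1" "- 1"] bm_bm[of _ _ i _ "- 1" "- 1"]
  from assms(2,4)[THEN index_cases] assms show "\<phi> ?lhs = \<phi> ?rhs"
    by (elim disjE conjE)
      (simp_all add: product_simps linear split del: if_split split_of_bool cong: sum.cong,
        simp_all add: expansion_simps sort_rows linear split del: if_split split_of_bool cong: sum.cong
          flip: sum_distrib_left, auto simp: algebra_simps power2_eq_square)
qed

text \<open>The factors 1 / 2 reflect that a second derivative of \<open>W1\<close> is twice a mode
  -3.\<close>

lemma W2_nprod_W2_0:
  assumes "p \<in> I2" "q \<in> I" "i \<in> I2" "j \<in> I"
  shows "W2 p q \<langle>0\<rangle> W2 i j =
          \<delta> (q \<in> I2) \<odot> (W2 p j \<langle>- 1\<rangle> W1 i q)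
    - \<delta> (j \<in> I2) \<odot> (W1 p j \<langle>- 1\<rangle> W2 i q)
    + (\<alpha>\<^sub>1 * \<delta> (q \<in> I2 \<and> j \<in> I2)) \<odot> ((\<partial> (W1 p j)) \<langle>- 1\<rangle> W1 i q)
    + \<delta> (q \<in> I2 \<and> j \<in> I2) \<odot> ((\<partial> (W1 p q)) \<langle>- 1\<rangle> W1 i j)
    - \<delta> (q = i) \<odot> (\<Sum>w\<in>I1. W1 w j \<langle>- 1\<rangle> W2 p w)
    - (\<delta> (q = i) * \<delta> (p = j)) \<odot>
            (\<Sum>a\<in>I1. \<Sum>w\<in>I1. (\<partial> (W1 w a)) \<langle>- 1\<rangle> W1 a w)
    - (\<delta> (q = i) * \<alpha>\<^sub>2) \<odot> \<partial> (W2 p j)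
    + (\<delta> (q = i) * \<delta> (j \<in> I2)) \<odot> (\<Sum>w\<in>I1. (\<partial> (W1 p j)) \<langle>- 1\<rangle> W1 w w)
    - (\<delta> (p = j) * \<delta> (q = i) * (1 / 2) * (\<alpha>\<^sub>1 + 2 * \<alpha>\<^sub>2)) \<odot>
            (\<Sum>a\<in>I1. \<partial> (\<partial> (W1 a a)))
    - (\<delta> (i = q) * \<delta> (j \<in> I2) * ((\<alpha>\<^sub>1 * (\<alpha>\<^sub>1 + \<alpha>\<^sub>2) + 1) / 2)) \<odot> \<partial> (\<partial> (W1 p j))
    + \<delta> (p = j) \<odot> (\<Sum>a\<in>I1. W1 a q \<langle>- 1\<rangle> W2 i a)
    + (\<delta> (p = j) * \<delta> (q \<in> I2)) \<odot> (\<Sum>a\<in>I1. (\<partial> (W1 a a)) \<langle>- 1\<rangle> W1 i q)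
    - \<delta> (i = j) \<odot> \<partial> (W2 p q)
    - ((1 / 2) * \<delta> (i = j) * \<delta> (q \<in> I2) * (\<alpha>\<^sub>1 + 2 * \<alpha>\<^sub>2)) \<odot> \<partial> (\<partial> (W1 p q))
    - ((1 / 2) * \<delta> (i = j) * \<delta> (p = q)) \<odot> \<partial> (\<partial> (\<Sum>w\<in>I1. W1 w w))"
    (is "?lhs = ?rhs")
proof (rule eq_by_functionals)
  fix \<phi>
  assume "functional \<phi>"
  note linear = vector_linear functional_linear[OF this]
  note sort_rows = am_am[of p _ _ _ "- 1" "- 1"] am_am[of _ _ i _ "- 1" "- 1"]
    bm_bm[of p _ _ _ "- 1" "- 1"] bm_bm[of _ _ i _ "- 1" "- 1"]
  from assms(2,4)[THEN index_cases] assms show "\<phi> ?lhs = \<phi> ?rhs"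
    by (elim disjE conjE)
      (simp_all add: product_simps linear split del: if_split split_of_bool cong: sum.cong,
        simp_all add: expansion_simps sort_rows
          \<comment> \<open>Mixed double sums are brought to one fixed order. The explicitly given
            cubic sum has \<open>u\<close> outside when it comes from the left-hand side and
            \<open>w\<close> outside when it comes from \<open>W1 w j\<close> times
            \<open>W2 p w\<close>.\<close>
          sum.swap[of _ I1 I2]
          sum.swap[of "\<lambda>u w. \<phi> (am w j (- 1) (am u w (- 1) (am p u (- 1) \<Omega>)))" I1 I1]
          linear split del: if_split split_of_bool cong: sum.cong
          flip: sum_distrib_left, auto simp: algebra_simps add_divide_distrib diff_divide_distrib)
qed

section \<open>Membership in the W-algebra\<close>

lemma V_b_subspace: "subspace (V_b V m n x)"
  by (simp add: V_b_def subspace_span)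

lemma monomial_in_V_b:
  "w \<in> words (b_basis m n) \<Longrightarrow> monomial V x w \<in> V_b V m n x"
  by (simp add: V_b_def span_base)

lemma gen_in_V_b:
  assumes "g \<in> b_basis m n"
  shows "x g \<in> V_b V m n x" "\<partial> (x g) \<in> V_b V m n x"
  using monomial_in_V_b[of "[(g, 1)]"] monomial_in_V_b[of "[(g, 2)]"] assms
  by (simp_all add: words_def vacuum_right transl_def)

lemma gen_nprod_in_V_b:
  assumes "g \<in> b_basis m n" "h \<in> b_basis m n"
  shows "x g \<langle>- 1\<rangle> x h \<in> V_b V m n x"
  using monomial_in_V_b[of "[(g, 1), (h, 1)]"] assms by (simp add: words_def vacuum_right)

lemmas in_V_b = gen_in_V_b gen_nprod_in_V_b gen_in_basis
  subspace_add[OF V_b_subspace] subspace_diff[OF V_b_subspace] subspace_scale[OF V_b_subspace]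
  subspace_sum[OF V_b_subspace]

lemma I_split: "I = I1 \<union> I2" "I1 \<inter> I2 = {}"
  by (auto simp: I_def I1_def I2_def)

context
  fixes d
  assumes d: "W_differential V m n \<alpha>\<^sub>2 x d"
begin

interpretation W_differential V m n \<alpha>\<^sub>2 x d
  by (rule d)

lemma d_zero: "d 0 = 0"
  using d_smul[of 0 0] subspace_0[OF V_b_subspace] by simp

text \<open>Linearity of \<open>d\<close> is known only on \<open>V_b\<close>, so each use carries
  membership side conditions, discharged by \<open>in_V_b\<close>.\<close>

lemma d_diff:
  assumes "u \<in> V_b V m n x" "v \<in> V_b V m n x"
  shows "d (u - v) = d u - d v"
  using d_add[of u "(- 1) \<odot> v"] d_smul[of v "- 1"] assms subspace_neg[OF V_b_subspace, of v]
  by simp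

lemma d_sum:
  assumes "finite S" "\<And>u. u \<in> S \<Longrightarrow> f u \<in> V_b V m n x"
  shows "d (\<Sum>u\<in>S. f u) = (\<Sum>u\<in>S. d (f u))"
  using assms by (induction S) (simp_all add: d_zero d_add subspace_sum[OF V_b_subspace])

lemma d_a:
  assumes "i \<in> I" "j \<in> I"
  shows "d (x (E i j)) = guard (i \<in> I2) (x (Psi (i + n) j))"
  using assms d_gen[OF gen_in_basis(1)[OF assms]] by (auto simp: guard_def I_def I2_def col_def)

lemma d_b:
  assumes "i \<in> I2" "j \<in> I2"
  shows "d (x (E (i + n) (j + n))) = - x (Psi (i + n) j)"
proof -
  have "m < i + n" "m < j + n"
    using assms by (simp_all add: mode_index_bounds)
  moreover have "{r \<in> {1..m + n}. 2 > col m r \<and> col m r \<ge> 2} = {}"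
      "{r \<in> {1..m + n}. 2 < col m r \<and> col m r \<le> 2} = {}"
    by auto
  ultimately show ?thesis
    using d_gen[OF gen_in_basis(2)[OF assms]] by (simp add: col_def)
qed

text \<open>The first sum in the differential runs over all of the first column; splitting it into
  \<open>I1\<close> and \<open>I2\<close> matches it with the two quadratic sums of
  \<open>W2\<close>. The second runs over the second column and is reindexed by rows.\<close>

lemma d_c:
  assumes "i \<in> I2" "j \<in> I"
  shows "d (x (E (i + n) j)) = (\<Sum>u\<in>I1. x (E u j) \<langle>- 1\<rangle> x (Psi (i + n) u))
    + (\<Sum>u\<in>I2. x (E u j) \<langle>- 1\<rangle> x (Psi (i + n) u))
    - (\<Sum>u\<in>I2. x (Psi (u + n) j) \<langle>- 1\<rangle> x (E (i + n) (u + n))) + \<alpha>\<^sub>2 \<odot> \<partial> (x (Psi (i + n) j))"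
proof -
  have cols: "col m (i + n) = 2" "col m j = 1" and out: "\<not> i + n \<le> m" "\<not> m < j"
    using assms by (auto simp: col_def I_def I2_def)
  have "{r \<in> {1..m + n}. 2 > col m r \<and> col m r \<ge> 1} = I"
    by (auto simp: col_def I_def)
  moreover have "r \<in> (\<lambda>u. u + n) ` I2" if "m < r" "r \<le> m + n" for r
    using that n_le_m by (intro image_eqI[of _ _ "r - n"]) (auto simp: I2_def)
  then have "{r \<in> {1..m + n}. 1 < col m r \<and> col m r \<le> 2} = (\<lambda>u. u + n) ` I2"
    by (auto simp: col_def I2_def split: if_splits)
  moreover have "inj_on (\<lambda>u. u + n) I2"
    by simp
  ultimately show ?thesis
    using d_gen[OF gen_in_basis(3)[OF assms]] cols out
    by (simp add: sum.reindex I_split sum.union_disjoint transl_def)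
qed

text \<open>If row i has one box, \<open>d\<close> kills the single summand. Otherwise j must also
  have two boxes, so that the second-column summand cancels the odd generator produced by the
  first.\<close>

lemma W1_in_W_algebra:
  assumes "i \<in> I" "j \<in> I" "i \<in> I2 \<Longrightarrow> j \<in> I2"
  shows "W1 i j \<in> W_algebra V m n x d"
proof -
  have W1: "W1 i j = x (E i j) + guard (i \<in> I2) (guard (j \<in> I2) (x (E (i + n) (j + n))))"
    by (simp add: W1_def mode_defs vacuum_right)
  show ?thesis
  proof (cases "i \<in> I2")
    case True
    then show ?thesis
      using assms unfolding W_algebra_def W1 by (simp add: in_V_b d_add d_a d_b)
  next
    case False
    then show ?thesis
      using assms unfolding W_algebra_def W1 by (simp add: in_V_b d_a)
  qed
qed

text \<open>Each term of \<open>d_c\<close> has one partner: the sum over \<open>I1\<close> cancels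
  against \<open>?Q1\<close>, the two sums over \<open>I2\<close> against the two factors of
  \<open>?Q2\<close>, and the derivative against the \<open>\<alpha>\<^sub>2\<close> term.\<close>

lemma W2_in_W_algebra:
  assumes "i \<in> I2" "j \<in> I"
  shows "W2 i j \<in> W_algebra V m n x d"
proof -
  let ?Q2 = "\<Sum>u\<in>I2. x (E u j) \<langle>- 1\<rangle> x (E (i + n) (u + n))"
  let ?Q1 = "\<Sum>u\<in>I1. x (E u j) \<langle>- 1\<rangle> x (E i u)"
  have W2: "W2 i j = x (E (i + n) j) - \<alpha>\<^sub>2 \<odot> \<partial> (x (E i j)) + ?Q2 - ?Q1"
    by (simp add: W2_def mode_defs vacuum_right transl_def)
  have mem: "?Q2 \<in> V_b V m n x" "?Q1 \<in> V_b V m n x"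
    using assms by (simp_all add: in_V_b)
  have "d ?Q2 = (\<Sum>u\<in>I2. x (Psi (u + n) j) \<langle>- 1\<rangle> x (E (i + n) (u + n)))
      - (\<Sum>u\<in>I2. x (E u j) \<langle>- 1\<rangle> x (Psi (i + n) u))"
    using assms
    by (simp add: d_sum in_V_b d_nprod d_a d_b nprod_uminus_right sum_subtractf cong: sum.cong)
  moreover have "d ?Q1 = (\<Sum>u\<in>I1. x (E u j) \<langle>- 1\<rangle> x (Psi (i + n) u))"
    using assms by (simp add: d_sum in_V_b d_nprod d_a cong: sum.cong)
  moreover have "d (\<partial> (x (E i j))) = \<partial> (x (Psi (i + n) j))"
    using assms by (simp add: d_transl in_V_b d_a)
  ultimately have "d (W2 i j) = 0"
    unfolding W2 using assms mem by (simp add: d_add d_diff d_smul in_V_b d_c)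
  then show ?thesis
    using assms mem unfolding W_algebra_def W2 by (simp add: in_V_b)
qed

end

end

theorem theorem4p9:
  fixes V :: "'v::ab_group_add vertex_structure" (structure)
    and x :: "gen \<Rightarrow> 'v" and d\<^sub>0 :: "'v \<Rightarrow> 'v"
    and m n :: nat and k \<alpha>\<^sub>1 \<alpha>\<^sub>2 :: complex
  assumes "m \<ge> n" and "n \<ge> 1"
    and "\<alpha>\<^sub>1 = k + of_nat n" and "\<alpha>\<^sub>2 = k + of_nat m"
    and "universal_affine V (a_basis m n) is_psi bracket (form m \<alpha>\<^sub>1 \<alpha>\<^sub>2) x"
    and "W_differential V m n \<alpha>\<^sub>2 x d\<^sub>0"
  shows "let W1 = W1_elem V m n x; W2 = W2_elem V m n \<alpha>\<^sub>2 x in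
    (\<forall>(i, j)\<in>W1_range m n. W1 i j \<in> W_algebra V m n x d\<^sub>0) \<and>
    (\<forall>i\<in>{m - n<..m}. \<forall>j\<in>{1..m}. W2 i j \<in> W_algebra V m n x d\<^sub>0) \<and>
    (\<forall>p\<in>{m - n<..m}. \<forall>i\<in>{m - n<..m}. \<forall>q\<in>{1..m}. \<forall>j\<in>{1..m}.
      W2 p q \<langle>0\<rangle> W2 i j =
          \<delta> (q > m - n) \<odot> (W2 p j \<langle>- 1\<rangle> W1 i q)
        - \<delta> (j > m - n) \<odot> (W1 p j \<langle>- 1\<rangle> W2 i q)
        + (\<alpha>\<^sub>1 * \<delta> (q > m - n \<and> j > m - n)) \<odot> ((\<partial> (W1 p j)) \<langle>- 1\<rangle> W1 i q)
        + \<delta> (q > m - n \<and> j > m - n) \<odot> ((\<partial> (W1 p q)) \<langle>- 1\<rangle> W1 i j)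
        - \<delta> (q = i) \<odot> (\<Sum>w\<in>{1..m - n}. W1 w j \<langle>- 1\<rangle> W2 p w)
        - (\<delta> (q = i) * \<delta> (p = j)) \<odot>
            (\<Sum>a\<in>{1..m - n}. \<Sum>w\<in>{1..m - n}. (\<partial> (W1 w a)) \<langle>- 1\<rangle> W1 a w)
        - (\<delta> (q = i) * \<alpha>\<^sub>2) \<odot> \<partial> (W2 p j)
        + (\<delta> (q = i) * \<delta> (j > m - n)) \<odot> (\<Sum>w\<in>{1..m - n}. (\<partial> (W1 p j)) \<langle>- 1\<rangle> W1 w w)
        - (\<delta> (p = j) * \<delta> (q = i) * (1 / 2) * (\<alpha>\<^sub>1 + 2 * \<alpha>\<^sub>2)) \<odot>
            (\<Sum>a\<in>{1..m - n}. \<partial> (\<partial> (W1 a a)))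
        - (\<delta> (i = q) * \<delta> (j > m - n) * ((\<alpha>\<^sub>1 * (\<alpha>\<^sub>1 + \<alpha>\<^sub>2) + 1) / 2)) \<odot> \<partial> (\<partial> (W1 p j))
        + \<delta> (p = j) \<odot> (\<Sum>a\<in>{1..m - n}. W1 a q \<langle>- 1\<rangle> W2 i a)
        + (\<delta> (p = j) * \<delta> (q > m - n)) \<odot> (\<Sum>a\<in>{1..m - n}. (\<partial> (W1 a a)) \<langle>- 1\<rangle> W1 i q)
        - \<delta> (i = j) \<odot> \<partial> (W2 p q)
        - ((1 / 2) * \<delta> (i = j) * \<delta> (q > m - n) * (\<alpha>\<^sub>1 + 2 * \<alpha>\<^sub>2)) \<odot> \<partial> (\<partial> (W1 p q))
        - ((1 / 2) * \<delta> (i = j) * \<delta> (p = q)) \<odot> \<partial> (\<partial> (\<Sum>w\<in>{1..m - n}. W1 w w)) \<and>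
      W2 p q \<langle>1\<rangle> W2 i j =
          (\<delta> (q > m - n \<and> j > m - n) * \<alpha>\<^sub>1) \<odot> (W1 p j \<langle>- 1\<rangle> W1 i q)
        + \<delta> (q > m - n \<and> j > m - n) \<odot> (W1 p q \<langle>- 1\<rangle> W1 i j)
        - (\<delta> (q = i) * \<alpha>\<^sub>2) \<odot> W2 p j
        + (\<delta> (q = i) * \<delta> (j > m - n)) \<odot> (\<Sum>w\<in>{1..m - n}. W1 p j \<langle>- 1\<rangle> W1 w w)
        - (\<delta> (q = i) * \<delta> (j > m - n) * \<alpha>\<^sub>1 * (\<alpha>\<^sub>1 + \<alpha>\<^sub>2)) \<odot> \<partial> (W1 p j)
        - (\<delta> (p = j) * \<alpha>\<^sub>2) \<odot> W2 i q
        + (\<delta> (p = j) * \<delta> (q > m - n)) \<odot> (\<Sum>a\<in>{1..m - n}. W1 a a \<langle>- 1\<rangle> W1 i q)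
        - (\<delta> (i = j) * (1 + \<delta> (q \<le> m - n))) \<odot> W2 p q
        - (2 * \<delta> (i = j) * \<delta> (q > m - n) * \<alpha>\<^sub>2) \<odot> \<partial> (W1 p q)
        - (\<delta> (p = q) * (1 + \<delta> (j \<le> m - n))) \<odot> W2 i j
        - (\<delta> (p = j) * \<delta> (i = q)) \<odot>
            (\<Sum>a\<in>{1..m - n}. \<Sum>w\<in>{1..m - n}. W1 w a \<langle>- 1\<rangle> W1 a w)
        - (\<delta> (q = i) * \<delta> (p = j) * (\<alpha>\<^sub>1 + 2 * \<alpha>\<^sub>2)) \<odot> (\<Sum>a\<in>{1..m - n}. \<partial> (W1 a a)) \<and>
      W2 p q \<langle>2\<rangle> W2 i j =
          (\<delta> (p = j) * \<delta> (q > m - n) * (\<alpha>\<^sub>1 * (\<alpha>\<^sub>1 + \<alpha>\<^sub>2) - 1)) \<odot> W1 i q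
        + (\<delta> (i = j) * \<delta> (q > m - n) * (\<alpha>\<^sub>1 - 2 * \<alpha>\<^sub>2)) \<odot> W1 p q
        - (\<delta> (i = q) * \<delta> (j > m - n) * (\<alpha>\<^sub>1 * (\<alpha>\<^sub>1 + \<alpha>\<^sub>2) - 1)) \<odot> W1 p j
        - (\<delta> (p = q) * \<delta> (j > m - n) * (\<alpha>\<^sub>1 - 2 * \<alpha>\<^sub>2)) \<odot> W1 i j \<and>
      W2 p q \<langle>3\<rangle> W2 i j =
          ((1 + \<alpha>\<^sub>1\<^sup>2 - 6 * \<alpha>\<^sub>2\<^sup>2) * \<delta> (p = q) * \<delta> (i = j)) \<odot> \<Omega>
        + ((6 * \<alpha>\<^sub>1 * \<alpha>\<^sub>2 * of_nat (m - n) + \<alpha>\<^sub>1 + \<alpha>\<^sub>2 + \<alpha>\<^sub>1\<^sup>2 * of_nat (m - n)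
             - \<alpha>\<^sub>1 * (of_nat (m - n))\<^sup>2 - 6 * \<alpha>\<^sub>2\<^sup>2 * \<alpha>\<^sub>1) * \<delta> (p = j) * \<delta> (i = q)) \<odot> \<Omega>)"
proof -
  interpret universal_affine V "a_basis m n" is_psi bracket "form m \<alpha>\<^sub>1 \<alpha>\<^sub>2" x
    by fact
  interpret pyramid_affine V m n \<alpha>\<^sub>1 \<alpha>\<^sub>2 x
    using assms(1,3,4) by unfold_locales (simp_all add: of_nat_diff)
  have range: "I2 \<subseteq> I" "{m - n<..m} = I2" "{1..m} = I" "{1..m - n} = I1"
    by (auto simp: I_def I1_def I2_def)
  \<comment> \<open>These equivalences need a row in \<open>I\<close>, since \<open>I1\<close>
    starts at 1 and \<open>I2\<close> ends at m; they apply once the bounded variables are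
    fixed.\<close>
  have half: "q \<in> I \<Longrightarrow> m - n < q \<longleftrightarrow> q \<in> I2" "q \<in> I \<Longrightarrow> q \<le> m - n \<longleftrightarrow> q \<in> I1" for q
    by (auto simp: I_def I1_def I2_def)
  show ?thesis
    unfolding Let_def W2_elem_eq range
  proof (intro conjI ballI)
    fix ij
    assume "ij \<in> W1_range m n"
    then show "case ij of (i, j) \<Rightarrow> W1_elem V m n x i j \<in> W_algebra V m n x d\<^sub>0"
      using range by (auto simp: W1_range_def W1_elem_eq intro!: W1_in_W_algebra[OF assms(6)])
  next
    fix i j
    assume "i \<in> I2" "j \<in> I"
    then show "W2 i j \<in> W_algebra V m n x d\<^sub>0"
      by (rule W2_in_W_algebra[OF assms(6)])
  qed (simp_all only: half W1_elem_eq index_sets W2_nprod_W2_0 W2_nprod_W2_1 W2_nprod_W2_2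
      W2_nprod_W2_3 cong: sum.cong)
qed

end
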